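(* Let $f:\mathbb R^n\to\mathbb R^n$ be a smooth vector field and let $\varphi$ be the local flow on $\mathbb R^n$ induced by $x'=f(x)$. Assume $\varphi(T,x_0)=x_0$ for some minimal $T>0$, and assume that $\lambda=1$ is an eigenvalue of $M:=D_x\varphi(T,x_0)$ of multiplicity one. Let $\Pi=\{x\in\mathbb R^n : \alpha(x)=0\}$ be a local Poincaré section with $x_0\in\Pi$, where $\alpha:\mathbb R^n\to\mathbb R$ is smooth and $0$ is a regular value of $\alpha$. Let $t_\Pi$ be the associated (local) return time function near $x_0$, with $t_\Pi(x_0)=T$. Then $$\ker Dt_\Pi(x_0)=T_{x_0}\Pi \iff D\alpha(x_0)\text{ is a left eigenvector of } M \text{ for the eigenvalue } \lambda=1.$$ In such a case, $t_\Pi(x)=t_\Pi(x_0)+O(\|x-x_0\|^2)$ for $x\in\Pi$ (as $x\to x_0$).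
   Context: For a scalar function $\alpha:\mathbb R^n\to\mathbb R$, the derivative $D\alpha(x)$ is regarded as a $1$-form (row vector) on $\mathbb R^n$. A nonzero $1$-form (row vector) $w$ is a left eigenvector of $M\in\mathbb R^{n\times n}$ for the eigenvalue $\lambda$ if $wM=\lambda w$, equivalently $M^Tw^T=\lambda w^T$. $T_{x_0}\Pi$ is the tangent space to $\Pi$ at $x_0$, a linear subspace of $\mathbb R^n$. That $\Pi$ is a local Poincaré section at $x_0$ means that near $x_0$ it is a codimension-one submanifold transversal to the flow; in particular $D\alpha(x_0)f(x_0)\neq 0$. The return time $t_\Pi$ is the smooth real function defined on a neighbourhood of $x_0$ in $\mathbb R^n$ that is uniquely determined near $x_0$ by $\alpha(\varphi(t_\Pi(x),x))=0$ and $t_\Pi(x_0)=T$ (implicit function theorem). For $x\in\Pi$ near $x_0$ it is the time of return to the part of $\Pi$ near $x_0$. $Dt_\Pi(x_0)$ is its derivative at $x_0$, a $1$-form on $\mathbb R^n$. *)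

theory Defs
  imports
    "HOL-Analysis.Analysis"
    "HOL-Library.Landau_Symbols"
    "HOL-Computational_Algebra.Polynomial"
begin

text \<open>Iterated directional derivatives keep all derivatives of \<open>g\<close> in one type, which makes the
  recursion typable. The notion is meant for open \<open>S\<close>, as derivatives are taken at full
  neighbourhoods.\<close>

primrec higher_differentiable_on ::
    "'a::real_normed_vector set \<Rightarrow> ('a \<Rightarrow> 'b::real_normed_vector) \<Rightarrow> nat \<Rightarrow> bool" where
  "higher_differentiable_on S g 0 \<longleftrightarrow> continuous_on S g"
| "higher_differentiable_on S g (Suc k) \<longleftrightarrow>
     (\<forall>x\<in>S. g differentiable (at x)) \<and>
     (\<forall>v. higher_differentiable_on S (\<lambda>x. frechet_derivative g (at x) v) k)"

definition smooth_on :: "'a::real_normed_vector set \<Rightarrow> ('a \<Rightarrow> 'b::real_normed_vector) \<Rightarrow> bool" where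
  "smooth_on S g \<longleftrightarrow> (\<forall>k. higher_differentiable_on S g k)"

definition ivp_solution ::
    "('a::real_normed_vector \<Rightarrow> 'a) \<Rightarrow> 'a \<Rightarrow> real set \<Rightarrow> (real \<Rightarrow> 'a) \<Rightarrow> bool" where
  "ivp_solution f x J y \<longleftrightarrow>
     open J \<and> is_interval J \<and> 0 \<in> J \<and> y 0 = x \<and>
     (\<forall>t\<in>J. (y has_vector_derivative f (y t)) (at t))"

text \<open>The local flow is given by maximal solutions: \<open>(t, x)\<close> is in its domain iff some
  solution starting at \<open>x\<close> exists up to time \<open>t\<close>. For locally Lipschitz \<open>f\<close> all such solutions
  agree at \<open>t\<close>, so that the definite description below is well defined on the domain; its value
  outside is meaningless.\<close>

definition flow_domain :: "('a::real_normed_vector \<Rightarrow> 'a) \<Rightarrow> (real \<times> 'a) set" where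
  "flow_domain f = {(t, x). \<exists>J y. ivp_solution f x J y \<and> t \<in> J}"

definition flow :: "('a::real_normed_vector \<Rightarrow> 'a) \<Rightarrow> real \<Rightarrow> 'a \<Rightarrow> 'a" where
  "flow f t x = (THE z. \<exists>J y. ivp_solution f x J y \<and> t \<in> J \<and> y t = z)"

definition minimal_period :: "('a::real_normed_vector \<Rightarrow> 'a) \<Rightarrow> 'a \<Rightarrow> real \<Rightarrow> bool" where
  "minimal_period f x T \<longleftrightarrow>
     0 < T \<and> (T, x) \<in> flow_domain f \<and> flow f T x = x \<and>
     (\<forall>s. 0 < s \<and> s < T \<longrightarrow> flow f s x \<noteq> x)"

definition charpoly :: "real^'n^'n \<Rightarrow> real poly" where
  "charpoly A = det (mat [:0, 1:] - (\<chi> i j. [:A $ i $ j:]))"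

definition alg_multiplicity :: "real^'n^'n \<Rightarrow> real \<Rightarrow> nat" where
  "alg_multiplicity A l = order l (charpoly A)"

definition left_eigenvector :: "real^'n^'n \<Rightarrow> real \<Rightarrow> real^'n \<Rightarrow> bool" where
  "left_eigenvector A l w \<longleftrightarrow> w \<noteq> 0 \<and> w v* A = l *\<^sub>R w"

text \<open>The derivative of a scalar function as a row vector.\<close>

definition derivative_row :: "(real^'n \<Rightarrow> real) \<Rightarrow> real^'n \<Rightarrow> real^'n" where
  "derivative_row g x = (\<chi> i. frechet_derivative g (at x) (axis i 1))"

definition derivative_kernel :: "(real^'n \<Rightarrow> real) \<Rightarrow> real^'n \<Rightarrow> (real^'n) set" where
  "derivative_kernel g x = {v. frechet_derivative g (at x) v = 0}"

text \<open>Velocities at \<open>x\<close> of continuously differentiable curves in \<open>S\<close>.\<close>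

definition tangent_space :: "'a::real_normed_vector set \<Rightarrow> 'a \<Rightarrow> 'a set" where
  "tangent_space S x =
     {v. \<exists>e>0. \<exists>c. c C1_differentiable_on {-e<..<e} \<and> c ` {-e<..<e} \<subseteq> S \<and> c 0 = x \<and>
           (c has_vector_derivative v) (at 0)}"

definition regular_value :: "('a::real_normed_vector \<Rightarrow> 'b::real_normed_vector) \<Rightarrow> 'b \<Rightarrow> bool" where
  "regular_value g c \<longleftrightarrow> (\<forall>x. g x = c \<longrightarrow> surj (frechet_derivative g (at x)))"

text \<open>The middle conjunct says that \<open>P\<close> is a smooth submanifold of codimension one near \<open>x0\<close>.\<close>

definition local_poincare_section ::
    "('a::real_normed_vector \<Rightarrow> 'a) \<Rightarrow> 'a set \<Rightarrow> 'a \<Rightarrow> bool" where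
  "local_poincare_section f P x0 \<longleftrightarrow>
     x0 \<in> P \<and>
     (\<exists>U. open U \<and> x0 \<in> U \<and>
        (\<exists>b :: 'a \<Rightarrow> real. smooth_on U b \<and> P \<inter> U = {x\<in>U. b x = 0} \<and>
           (\<forall>x\<in>P \<inter> U. surj (frechet_derivative b (at x)))) \<and>
        (\<forall>x\<in>P \<inter> U. f x \<notin> tangent_space P x))"

text \<open>These conditions determine \<open>tau\<close> only near \<open>x0\<close>; its values elsewhere are irrelevant.\<close>

definition local_return_time ::
    "('a::real_normed_vector \<Rightarrow> 'a) \<Rightarrow> ('a \<Rightarrow> real) \<Rightarrow> 'a \<Rightarrow> real \<Rightarrow> ('a \<Rightarrow> real) \<Rightarrow> bool" where
  "local_return_time f \<alpha> x0 T tau \<longleftrightarrow>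
     tau x0 = T \<and>
     (\<exists>U. open U \<and> x0 \<in> U \<and> smooth_on U tau \<and>
        (\<forall>x\<in>U. (tau x, x) \<in> flow_domain f \<and> \<alpha> (flow f (tau x) x) = 0))"

end

theory Submission
  imports Defs
begin

text \<open>Differentiating \<open>\<alpha> (flow f (tau x) x) = 0\<close> at \<open>x0\<close> gives
  \<open>D\<alpha>(x0) M = - c Dt(x0)\<close> with \<open>Dt\<close> the derivative of \<open>tau\<close> and \<open>c = D\<alpha>(x0) f(x0) \<noteq> 0\<close> by
  transversality. Since the tangent space of the section is \<open>ker D\<alpha>(x0)\<close>, equality of the
  kernels means that \<open>Dt(x0)\<close> is a multiple of \<open>D\<alpha>(x0)\<close>, and evaluation at \<open>f(x0) = M f(x0)\<close> fixes
  the factor as \<open>- 1 / c\<close>. On the section \<open>D\<alpha>(x0) (x - x0)\<close> is of second order, hence so is the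
  increment of \<open>tau\<close>. That \<open>M\<close> is the derivative of the flow rests on Picard's theorem and
  Gronwall's inequality, applied to the variational equation.\<close>

subsection \<open>Smooth functions on compact convex sets\<close>

text \<open>The definite description behind \<open>flow\<close> gives no hold on nearby orbits.
  Solutions from a whole ball of initial points are therefore produced first, on one time interval
  reaching past \<open>T\<close>; only then can \<open>flow\<close> be identified with them and
  differentiated. Regularity enters through Lipschitz and second-order Taylor constants on balls,
  which are compact and convex, so that one constant serves a whole family of orbits. Smoothness
  controls the derivative in one direction at a time, hence these constants are assembled over the
  finite basis. The factor \<open>- 1 / c\<close> is exactly what closes the argument: inserted into
  the relation between \<open>M\<close> and the derivative of \<open>tau\<close>, it cancels
  \<open>c\<close> and leaves the eigenvector equation.\<close>

lemma smooth_on_continuous_on: "smooth_on U g \<Longrightarrow> continuous_on U g"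
  unfolding smooth_on_def using higher_differentiable_on.simps(1) by blast

lemma smooth_on_differentiable: "smooth_on U g \<Longrightarrow> x \<in> U \<Longrightarrow> g differentiable (at x)"
  unfolding smooth_on_def using higher_differentiable_on.simps(2) by blast

lemma smooth_on_has_derivative:
  "smooth_on U g \<Longrightarrow> x \<in> U \<Longrightarrow> (g has_derivative frechet_derivative g (at x)) (at x)"
  using smooth_on_differentiable frechet_derivative_works by blast

lemma smooth_on_frechet_derivative:
  "smooth_on U g \<Longrightarrow> smooth_on U (\<lambda>x. frechet_derivative g (at x) v)"
  unfolding smooth_on_def using higher_differentiable_on.simps(2) by blast

lemma smooth_on_bounded_linear_derivative:
  "smooth_on U g \<Longrightarrow> x \<in> U \<Longrightarrow> bounded_linear (frechet_derivative g (at x))"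
  using smooth_on_has_derivative has_derivative_bounded_linear by blast

text \<open>Derivatives along the finitely many basis vectors are continuous, hence bounded on
  \<open>C\<close>, and the operator norm is at most the sum of their norms.\<close>

lemma smooth_on_derivative_bound:
  fixes g :: "'a::euclidean_space \<Rightarrow> 'b::real_normed_vector"
  assumes g: "smooth_on U g" "C \<subseteq> U" and "compact C"
  shows "\<exists>B\<ge>0. \<forall>x\<in>C. onorm (frechet_derivative g (at x)) \<le> B"
proof -
  have "\<exists>B. \<forall>x\<in>C. norm (frechet_derivative g (at x) b) \<le> B" for b
  proof -
    have "continuous_on C (\<lambda>x. frechet_derivative g (at x) b)"
      using smooth_on_continuous_on[OF smooth_on_frechet_derivative[OF g(1)]] g(2)
        continuous_on_subset by blast
    then have "bounded ((\<lambda>x. frechet_derivative g (at x) b) ` C)"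
      using \<open>compact C\<close> compact_continuous_image compact_imp_bounded by blast
    then show ?thesis by (auto simp: bounded_iff)
  qed
  then obtain B where B: "\<And>b x. x \<in> C \<Longrightarrow> norm (frechet_derivative g (at x) b) \<le> B b"
    by metis
  \<comment> \<open>\<open>B b\<close> has no sign when \<open>C\<close> is empty; the absolute
    value keeps the bound nonnegative.\<close>
  have "onorm (frechet_derivative g (at x)) \<le> \<bar>\<Sum>b\<in>Basis. B b\<bar>" if x: "x \<in> C" for x
  proof -
    have "x \<in> U" using x g by blast
    then have "onorm (frechet_derivative g (at x))
        \<le> (\<Sum>b\<in>Basis. norm (frechet_derivative g (at x) b))"
      by (intro onorm_componentwise smooth_on_bounded_linear_derivative[OF g(1)])
    also have "\<dots> \<le> (\<Sum>b\<in>Basis. B b)"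
      by (intro sum_mono B x)
    finally show ?thesis by simp
  qed
  then show ?thesis by (intro exI[of _ "\<bar>\<Sum>b\<in>Basis. B b\<bar>"]) simp
qed

lemma smooth_on_lipschitz:
  fixes g :: "'a::euclidean_space \<Rightarrow> 'b::real_normed_vector"
  assumes g: "smooth_on U g" "C \<subseteq> U" and C: "compact C" "convex C"
  shows "\<exists>L\<ge>0. \<forall>x\<in>C. \<forall>y\<in>C. norm (g x - g y) \<le> L * norm (x - y)"
proof -
  obtain L where L: "L \<ge> 0" "\<And>x. x \<in> C \<Longrightarrow> onorm (frechet_derivative g (at x)) \<le> L"
    using smooth_on_derivative_bound[OF g C(1)] by blast
  have "norm (g x - g y) \<le> L * norm (x - y)" if xy: "x \<in> C" "y \<in> C" for x y
  proof (rule differentiable_bound[OF C(2) _ L(2) xy])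
    fix z assume "z \<in> C"
    then have "z \<in> U" using g by blast
    then show "(g has_derivative frechet_derivative g (at z)) (at z within C)"
      by (rule has_derivative_at_withinI[OF smooth_on_has_derivative[OF g(1)]])
  qed
  with L(1) show ?thesis by blast
qed

text \<open>Each directional derivative is Lipschitz on \<open>C\<close>, so along the segment from
  \<open>x\<close> to \<open>y\<close> the derivative changes by at most a multiple of the length,
  and linearization costs one more length. \<open>K\<close> does not depend on \<open>x\<close>, as
  an estimate along a whole orbit requires.\<close>

lemma smooth_on_taylor:
  fixes g :: "'a::euclidean_space \<Rightarrow> 'b::real_normed_vector"
  assumes "smooth_on U g" "C \<subseteq> U" "compact C" "convex C"
  shows "\<exists>K\<ge>0. \<forall>x\<in>C. \<forall>y\<in>C.
    norm (g y - g x - frechet_derivative g (at x) (y - x)) \<le> K * (norm (y - x))\<^sup>2"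
proof -
  have "\<exists>L\<ge>0. \<forall>x\<in>C. \<forall>y\<in>C. norm (frechet_derivative g (at x) b - frechet_derivative g (at y) b)
      \<le> L * norm (x - y)" for b
    by (rule smooth_on_lipschitz[OF smooth_on_frechet_derivative[OF assms(1)] assms(2-4)])
  then obtain L where L0: "\<And>b. L b \<ge> 0" and L: "\<And>b x y. x \<in> C \<Longrightarrow> y \<in> C \<Longrightarrow>
      norm (frechet_derivative g (at x) b - frechet_derivative g (at y) b) \<le> L b * norm (x - y)"
    by metis
  define K where "K = (\<Sum>b\<in>Basis. L b)"
  have K0: "K \<ge> 0" unfolding K_def by (intro sum_nonneg L0)
  have "norm (g y - g x - frechet_derivative g (at x) (y - x)) \<le> K * (norm (y - x))\<^sup>2"
    if xy: "x \<in> C" "y \<in> C" for x y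
  proof -
    let ?S = "closed_segment x y"
    have S: "?S \<subseteq> C" using assms(4) xy by (simp add: closed_segment_subset)
    have "norm (g y - g x - frechet_derivative g (at x) (y - x)) \<le> norm (y - x) * (K * norm (y - x))"
    proof (rule differentiable_bound_linearization[where S="?S"])
      fix t :: real assume "t \<in> {0..1}"
      then show "x + t *\<^sub>R (y - x) \<in> ?S"
        by (auto simp: closed_segment_def algebra_simps intro!: exI[of _ t])
    next
      fix z assume z: "z \<in> ?S"
      then have zC: "z \<in> C" and z': "z \<in> U" using S assms by auto
      show "(g has_derivative frechet_derivative g (at z)) (at z within ?S)"
        using smooth_on_has_derivative[OF assms(1) z'] has_derivative_at_withinI by blast
      have "norm (z - x) \<le> norm (y - x)" using segment_bound(1)[OF z] by simp
      have "x \<in> U" using xy assms by auto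
      then have "onorm (frechet_derivative g (at z) - frechet_derivative g (at x))
        \<le> (\<Sum>b\<in>Basis. norm ((frechet_derivative g (at z) - frechet_derivative g (at x)) b))"
        unfolding fun_diff_def
        by (intro onorm_componentwise bounded_linear_sub z'
            smooth_on_bounded_linear_derivative[OF assms(1)])
      also have "\<dots> \<le> (\<Sum>b\<in>Basis. L b * norm (z - x))"
        unfolding fun_diff_def by (intro sum_mono L zC xy)
      also have "\<dots> = K * norm (z - x)" by (simp add: K_def sum_distrib_right)
      also have "\<dots> \<le> K * norm (y - x)"
        using \<open>norm (z - x) \<le> norm (y - x)\<close> K0 by (intro mult_left_mono) auto
      finally show "onorm (frechet_derivative g (at z) - frechet_derivative g (at x))
          \<le> K * norm (y - x)" .
    qed simp
    then show ?thesis by (simp add: power2_eq_square algebra_simps)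
  qed
  with K0 show ?thesis by blast
qed

subsection \<open>Gronwall's inequality and Picard's theorem\<close>

text \<open>An energy argument: the norm may fail to be differentiable at zero, its square does not.
  The function \<open>p\<close>, the squared norm damped by \<open>exp (- k * s)\<close> minus
  \<open>e\<^sup>2 * s\<close>, has nonpositive derivative; a square root ends the proof.\<close>

lemma gronwall_forward:
  fixes z :: "real \<Rightarrow> 'a::real_inner"
  assumes der: "\<And>t. t \<in> {0..S} \<Longrightarrow> (z has_vector_derivative z' t) (at t within {0..S})"
    and bnd: "\<And>t. t \<in> {0..S} \<Longrightarrow> norm (z' t) \<le> L * norm (z t) + e"
    and nonneg: "L \<ge> 0" "e \<ge> 0" and t: "t \<in> {0..S}"
  shows "norm (z t) \<le> (norm (z 0) + e * (1 + S)) * exp ((L + 1) * S)"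
proof -
  \<comment> \<open>\<open>2 * L\<close> absorbs the linear growth and the rest absorbs the mixed
    term \<open>2 * norm (z s) * e\<close> up to \<open>e\<^sup>2\<close>. Being twice
    \<open>L + 1\<close>, \<open>k\<close> makes \<open>exp (k * S)\<close> the square of the factor
    in the claim.\<close>
  define k where "k = 2 * (L + 1)"
  have k0: "k \<ge> 0" using nonneg by (simp add: k_def)
  have eS: "e * (1 + S) \<ge> 0" using nonneg t by simp
  define p where "p s = exp (- k * s) * (z s \<bullet> z s) - e\<^sup>2 * s" for s
  define p' where "p' s = exp (- k * s) * (2 * (z s \<bullet> z' s) - k * (z s \<bullet> z s)) - e\<^sup>2" for s
  have dp: "(p has_derivative (\<lambda>h. h * p' s)) (at s within {0..t})" if "s \<in> {0..t}" for s
  proof -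
    have "(z has_vector_derivative z' s) (at s within {0..t})"
      using that t by (intro has_vector_derivative_within_subset[OF der]) auto
    then have "(z has_derivative (\<lambda>h. h *\<^sub>R z' s)) (at s within {0..t})"
      by (simp add: has_vector_derivative_def)
    then show ?thesis
      unfolding p_def p'_def
      by (auto intro!: derivative_eq_intros ext simp: algebra_simps inner_commute)
  qed
  have p'_le: "p' s \<le> 0" if "s \<in> {0..t}" for s
  proof -
    have s: "s \<in> {0..S}" using that t by auto
    let ?n = "norm (z s)"
    have "z s \<bullet> z' s \<le> ?n * norm (z' s)"
      by (rule norm_cauchy_schwarz)
    also have "\<dots> \<le> ?n * (L * ?n + e)"
      by (intro mult_left_mono bnd s) auto
    finally have "2 * (z s \<bullet> z' s) \<le> 2 * L * ?n\<^sup>2 + 2 * ?n * e"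
      by (simp add: power2_eq_square algebra_simps)
    also have "\<dots> \<le> 2 * L * ?n\<^sup>2 + 2 * ?n\<^sup>2 + e\<^sup>2"
    proof -
      have "2 * ?n * e \<le> ?n\<^sup>2 + e\<^sup>2" by (rule sum_squares_bound)
      moreover have "0 \<le> ?n\<^sup>2" by simp
      ultimately show ?thesis by linarith
    qed
    also have "\<dots> = k * ?n\<^sup>2 + e\<^sup>2"
      by (simp add: k_def algebra_simps)
    finally have *: "2 * (z s \<bullet> z' s) - k * (z s \<bullet> z s) \<le> e\<^sup>2"
      by (simp add: power2_norm_eq_inner)
    have "exp (- k * s) \<le> 1" using s k0 by simp
    have "exp (- k * s) * (2 * (z s \<bullet> z' s) - k * (z s \<bullet> z s)) \<le> exp (- k * s) * e\<^sup>2"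
      using * by (intro mult_left_mono) auto
    also have "\<dots> \<le> 1 * e\<^sup>2" using \<open>exp (- k * s) \<le> 1\<close> by (intro mult_right_mono) auto
    finally show ?thesis unfolding p'_def by simp
  qed
  have "p t \<le> p 0"
  proof (cases "t = 0")
    case False
    then have "0 < t" using t by auto
    then obtain s where "s \<in> {0<..<t}" "p t - p 0 = (t - 0) * p' s"
      using mvt_simple[of 0 t p "\<lambda>s h. h * p' s"] dp by auto
    moreover then have "t * p' s \<le> 0" using p'_le[of s] \<open>0 < t\<close>
      by (auto intro!: mult_nonneg_nonpos)
    ultimately show ?thesis by simp
  qed simp
  then have "exp (- k * t) * (norm (z t))\<^sup>2 \<le> (norm (z 0))\<^sup>2 + e\<^sup>2 * t"
    by (simp add: p_def power2_norm_eq_inner)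
  then have "(norm (z t))\<^sup>2 \<le> ((norm (z 0))\<^sup>2 + e\<^sup>2 * t) * exp (k * t)"
    by (simp add: exp_minus field_simps)
  also have "\<dots> \<le> (norm (z 0) + e * (1 + S))\<^sup>2 * exp (k * S)"
  proof (intro mult_mono)
    have "e\<^sup>2 * t \<le> e\<^sup>2 * (1 + S)\<^sup>2"
    proof (rule mult_left_mono)
      \<comment> \<open>The bound must be a square for the root to be taken. As \<open>1 + S\<close>
        is at least 1 and at least \<open>t\<close>, its square dominates \<open>t\<close>; the
        square of \<open>S\<close> would not for short intervals.\<close>
      show "t \<le> (1 + S)\<^sup>2"
        using t self_le_power[of "1 + S" 2] by simp
    qed simp
    moreover have "0 \<le> 2 * norm (z 0) * (e * (1 + S))" using eS by simp
    moreover have "(norm (z 0) + e * (1 + S))\<^sup>2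
        = (norm (z 0))\<^sup>2 + e\<^sup>2 * (1 + S)\<^sup>2 + 2 * norm (z 0) * (e * (1 + S))"
      unfolding power2_sum[of "norm (z 0)"] power_mult_distrib ..
    ultimately show "(norm (z 0))\<^sup>2 + e\<^sup>2 * t \<le> (norm (z 0) + e * (1 + S))\<^sup>2"
      by linarith
  qed (use t nonneg k0 in \<open>auto intro!: mult_left_mono\<close>)
  also have "\<dots> = ((norm (z 0) + e * (1 + S)) * exp ((L + 1) * S))\<^sup>2"
    by (simp add: k_def power_mult_distrib exp_double[symmetric] mult.assoc)
  finally show ?thesis
    by (rule power2_le_imp_le) (use eS in simp)
qed

text \<open>Times before 0 are reduced to the forward case by reflecting \<open>z\<close>. This
  version compares solutions on an interval with 0 in its interior.\<close>

lemma gronwall: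
  fixes z :: "real \<Rightarrow> 'a::real_inner"
  assumes der: "\<And>t. t \<in> {a..b} \<Longrightarrow> (z has_vector_derivative z' t) (at t within {a..b})"
    and bnd: "\<And>t. t \<in> {a..b} \<Longrightarrow> norm (z' t) \<le> L * norm (z t)"
    and nonneg: "L \<ge> 0" and ab: "a \<le> 0" "0 \<le> b" and t: "t \<in> {a..b}"
  shows "norm (z t) \<le> norm (z 0) * exp ((L + 1) * (b - a))"
proof (cases "t \<ge> 0")
  case True
  have "norm (z t) \<le> (norm (z 0) + 0 * (1 + b)) * exp ((L + 1) * b)"
  proof (rule gronwall_forward[of b z z' L 0])
    fix s assume "s \<in> {0..b}"
    then show "(z has_vector_derivative z' s) (at s within {0..b})"
      using ab by (intro has_vector_derivative_within_subset[OF der]) auto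
  qed (use t True nonneg ab in \<open>auto intro!: bnd\<close>)
  also have "\<dots> \<le> norm (z 0) * exp ((L + 1) * (b - a))"
  proof -
    have "(L + 1) * b \<le> (L + 1) * (b - a)"
      using ab nonneg by (intro mult_left_mono) auto
    then show ?thesis by (simp add: mult_left_mono)
  qed
  finally show ?thesis .
next
  case False
  have "norm ((z \<circ> uminus) (- t)) \<le> (norm ((z \<circ> uminus) 0) + 0 * (1 + - a)) * exp ((L + 1) * - a)"
  proof (rule gronwall_forward[of "- a" _ "\<lambda>s. - z' (- s)" L 0])
    fix s assume s: "s \<in> {0..- a}"
    have "((\<lambda>s. - s) has_vector_derivative - 1) (at s within {0..- a})"
      by (auto intro!: derivative_eq_intros)
    moreover have "(z has_vector_derivative z' (- s)) (at (- s) within uminus ` {0..- a})"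
      using s ab by (intro has_vector_derivative_within_subset[OF der]) auto
    ultimately show "((z \<circ> uminus) has_vector_derivative - z' (- s)) (at s within {0..- a})"
      using vector_diff_chain_within[of uminus "- 1" s "{0..- a}" z "z' (- s)"] by simp
  next
    fix s assume s: "s \<in> {0..- a}"
    then show "norm (- z' (- s)) \<le> L * norm ((z \<circ> uminus) s) + 0"
      using bnd[of "- s"] ab by simp
  qed (use t False nonneg in auto)
  then have "norm (z t) \<le> norm (z 0) * exp ((L + 1) * - a)" by simp
  also have "\<dots> \<le> norm (z 0) * exp ((L + 1) * (b - a))"
  proof (rule mult_left_mono)
    have "(L + 1) * - a \<le> (L + 1) * (b - a)"
      using ab nonneg by (intro mult_left_mono) auto
    then show "exp ((L + 1) * - a) \<le> exp ((L + 1) * (b - a))" by simp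
  qed simp
  finally show ?thesis .
qed

text \<open>Integrating an exponential of rate \<open>K\<close> gains the factor
  \<open>1 / K\<close>, the source of the contraction in Picard's theorem.\<close>

lemma integral_exp_bound_forward:
  fixes h :: "real \<Rightarrow> 'a::banach"
  assumes h: "continuous_on {0..t} h" and t: "0 \<le> t" and K: "K > 0"
    and bnd: "\<And>s. s \<in> {0..t} \<Longrightarrow> norm (h s) \<le> B * exp (K * s)"
  shows "norm (integral {0..t} h) \<le> B / K * (exp (K * t) - 1)"
proof -
  have "((\<lambda>s. B * exp (K * s)) has_integral B / K * exp (K * t) - B / K * exp (K * 0)) {0..t}"
    using t K by (intro fundamental_theorem_of_calculus)
      (auto intro!: derivative_eq_intros simp: has_real_derivative_iff_has_vector_derivative[symmetric])
  moreover have "norm (integral {0..t} h) \<le> integral {0..t} (\<lambda>s. B * exp (K * s))"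
    by (rule integral_norm_bound_integral)
      (use h bnd in \<open>auto intro!: integrable_continuous_real continuous_intros\<close>)
  ultimately have "norm (integral {0..t} h) \<le> B / K * exp (K * t) - B / K * exp (K * 0)"
    using integral_unique by metis
  then show ?thesis by (simp add: right_diff_distrib)
qed

text \<open>The difference of integrals based at \<open>-S\<close> is the oriented integral from 0
  to \<open>t\<close> for either sign of \<open>t\<close>; a reflection handles
  \<open>t < 0\<close>.\<close>

lemma integral_exp_bound:
  fixes h :: "real \<Rightarrow> 'a::banach"
  assumes h: "continuous_on {-S..S} h" and t: "t \<in> {-S..S}" and K: "K > 0"
    and bnd: "\<And>s. s \<in> {-S..S} \<Longrightarrow> norm (h s) \<le> B * exp (K * \<bar>s\<bar>)"
  shows "norm (integral {-S..t} h - integral {-S..0} h) \<le> B / K * exp (K * \<bar>t\<bar>)"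
proof -
  have "B \<ge> 0" using bnd[of 0] norm_ge_zero[of "h 0"] t by (simp del: norm_ge_zero)
  then have BK: "B / K * (exp (K * \<bar>t\<bar>) - 1) \<le> B / K * exp (K * \<bar>t\<bar>)"
    using K by (intro mult_left_mono) auto
  have int: "h integrable_on {a..b}" if "-S \<le> a" "b \<le> S" for a b
    using that by (intro integrable_continuous_real continuous_on_subset[OF h]) auto
  show ?thesis
  proof (cases "t \<ge> 0")
    case True
    have "integral {-S..0} h + integral {0..t} h = integral {-S..t} h"
      using t True by (intro Henstock_Kurzweil_Integration.integral_combine int) auto
    then have "norm (integral {-S..t} h - integral {-S..0} h) = norm (integral {0..t} h)"
      by (metis add_diff_cancel_left')
    also have "\<dots> \<le> B / K * (exp (K * t) - 1)"
    proof (rule integral_exp_bound_forward)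
      show "norm (h s) \<le> B * exp (K * s)" if "s \<in> {0..t}" for s
        using bnd[of s] that t by auto
    qed (use t True K continuous_on_subset[OF h] in auto)
    finally show ?thesis using BK True by simp
  next
    case False
    have "integral {-S..t} h + integral {t..0} h = integral {-S..0} h"
      using t False by (intro Henstock_Kurzweil_Integration.integral_combine int) auto
    then have "norm (integral {-S..t} h - integral {-S..0} h) = norm (integral {t..0} h)"
      by (metis add_diff_cancel_left' norm_minus_commute)
    also have "integral {t..0} h = integral {0..-t} (\<lambda>s. h (- s))"
      using Henstock_Kurzweil_Integration.integral_reflect_real[of 0 t h] by simp
    also have "norm \<dots> \<le> B / K * (exp (K * - t) - 1)"
    proof (rule integral_exp_bound_forward)
      show "continuous_on {0..- t} (\<lambda>s. h (- s))"
        using t by (intro continuous_on_compose2[OF h] continuous_intros) auto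
      show "norm (h (- s)) \<le> B * exp (K * s)" if "s \<in> {0..- t}" for s
        using bnd[of "-s"] that t by auto
    qed (use False K in auto)
    finally show ?thesis using BK False by simp
  qed
qed

text \<open>The fixed point is sought for \<open>u t = exp (- K * \<bar>t\<bar>) *\<^sub>R y t\<close>: with \<open>K \<ge> 2 * L\<close> the Picard
  operator is a contraction on the whole interval, so that no gluing of short-time solutions is
  needed.\<close>

lemma global_picard:
  fixes G :: "real \<Rightarrow> 'a::banach \<Rightarrow> 'a"
  assumes S: "S > 0" and cont: "continuous_on ({-S..S} \<times> UNIV) (\<lambda>(t, x). G t x)"
    and lip: "\<And>t x y. t \<in> {-S..S} \<Longrightarrow> norm (G t x - G t y) \<le> L * norm (x - y)"
  shows "\<exists>y. y 0 = x \<and>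
    (\<forall>t\<in>{-S..S}. (y has_vector_derivative G t (y t)) (at t within {-S..S}))"
proof -
  \<comment> \<open>No sign of \<open>L\<close> is assumed, hence the absolute value; the added 1
    makes \<open>K\<close> positive. The contraction ratio will be \<open>\<bar>L\<bar> / K\<close>,
    at most one half.\<close>
  define K where "K = 2 * (\<bar>L\<bar> + 1)"
  have K: "K > 0" by (simp add: K_def)
  \<comment> \<open>The fixed point is taken in the type of bounded continuous functions on the
    whole line; clamping the time extends the iterates by their end values.\<close>
  define c where "c t = max (-S) (min S t)" for t :: real
  have c: "c t \<in> {-S..S}" for t using S by (auto simp: c_def)
  have c_id: "c t = t" if "t \<in> {-S..S}" for t using that by (auto simp: c_def)
  define h where "h u s = G s (exp (K * \<bar>s\<bar>) *\<^sub>R u s)" for u s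
  \<comment> \<open>A base point at the left end gives one formula for both signs of
    \<open>t\<close>; subtracting the integral up to 0 restores the initial value
    \<open>x\<close>.\<close>
  define I where "I u t = x + (integral {-S..t} (h u) - integral {-S..0} (h u))" for u t
  define F where "F u t = exp (- (K * \<bar>c t\<bar>)) *\<^sub>R I u (c t)" for u t
  have h_cont: "continuous_on {-S..S} (h u)" if "continuous_on UNIV u" for u
  proof -
    have "continuous_on {-S..S} ((\<lambda>(t, x). G t x) \<circ> (\<lambda>s. (s, exp (K * \<bar>s\<bar>) *\<^sub>R u s)))"
      by (intro continuous_on_compose continuous_intros continuous_on_subset[OF that]
          continuous_on_subset[OF cont]) auto
    then show ?thesis by (simp add: h_def[abs_def] o_def)
  qed
  have I_deriv: "(I u has_vector_derivative h u t) (at t within {-S..S})"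
    if "continuous_on UNIV u" "t \<in> {-S..S}" for u t
    unfolding I_def using integral_has_vector_derivative[OF h_cont that(2)] that(1)
    by (auto intro!: derivative_eq_intros)
  have F_bcontfun: "F u \<in> bcontfun" if u: "continuous_on UNIV u" for u
  proof -
    define J where "J t = exp (- (K * \<bar>t\<bar>)) *\<^sub>R I u t" for t
    have "continuous_on {-S..S} (I u)"
      using I_deriv[OF u] has_vector_derivative_continuous continuous_on_eq_continuous_within by blast
    then have J: "continuous_on {-S..S} J"
      unfolding J_def by (intro continuous_intros)
    have "continuous_on UNIV c" unfolding c_def by (intro continuous_intros)
    then have "continuous_on UNIV (\<lambda>t. J (c t))"
      by (rule continuous_on_compose2[OF J]) (use c in auto)
    moreover have "bounded (J ` {-S..S})"
      using J compact_continuous_image compact_imp_bounded by blast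
    then have "bounded (range (\<lambda>t. J (c t)))"
      by (rule bounded_subset) (use c in auto)
    ultimately show ?thesis
      by (simp add: bcontfun_def F_def[abs_def] J_def)
  qed
  define \<Phi> where "\<Phi> u = Bcontfun (F (apply_bcontfun u))" for u
  have \<Phi>: "apply_bcontfun (\<Phi> u) = F (apply_bcontfun u)" for u
    unfolding \<Phi>_def by (intro Bcontfun_inverse F_bcontfun) simp
  have "dist (\<Phi> u) (\<Phi> v) \<le> (1/2) * dist u v" for u v
  proof (rule dist_bound)
    fix t
    let ?u = "apply_bcontfun u" and ?v = "apply_bcontfun v"
    let ?hh = "\<lambda>s. h ?u s - h ?v s"
    have bnd: "norm (?hh s) \<le> (\<bar>L\<bar> * dist u v) * exp (K * \<bar>s\<bar>)" if "s \<in> {-S..S}" for s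
    proof -
      have "norm (?hh s) \<le> L * norm (exp (K * \<bar>s\<bar>) *\<^sub>R ?u s - exp (K * \<bar>s\<bar>) *\<^sub>R ?v s)"
        unfolding h_def by (rule lip[OF that])
      also have "\<dots> = L * (exp (K * \<bar>s\<bar>) * dist (?u s) (?v s))"
        by (simp add: scaleR_diff_right[symmetric] dist_norm)
      also have "\<dots> \<le> \<bar>L\<bar> * (exp (K * \<bar>s\<bar>) * dist u v)"
        by (intro mult_mono mult_left_mono dist_bounded) auto
      finally show ?thesis by (simp add: algebra_simps)
    qed
    have int: "h (apply_bcontfun w) integrable_on {-S..b}" if "b \<le> S" for w b
      using that by (intro integrable_continuous_real continuous_on_subset[OF h_cont]) auto
    have "I ?u (c t) - I ?v (c t) = integral {-S..c t} ?hh - integral {-S..0} ?hh"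
      using c[of t] S int by (simp add: I_def Henstock_Kurzweil_Integration.integral_diff)
    also have "norm \<dots> \<le> (\<bar>L\<bar> * dist u v) / K * exp (K * \<bar>c t\<bar>)"
      by (intro integral_exp_bound[OF _ c K bnd] continuous_intros h_cont) auto
    finally have *: "norm (I ?u (c t) - I ?v (c t)) \<le> (\<bar>L\<bar> * dist u v) / K * exp (K * \<bar>c t\<bar>)" .
    have "dist (\<Phi> u t) (\<Phi> v t) = exp (- (K * \<bar>c t\<bar>)) * norm (I ?u (c t) - I ?v (c t))"
      by (simp add: \<Phi> F_def dist_norm scaleR_diff_right[symmetric])
    also have "\<dots> \<le> exp (- (K * \<bar>c t\<bar>)) * ((\<bar>L\<bar> * dist u v) / K * exp (K * \<bar>c t\<bar>))"
      by (intro mult_left_mono *) auto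
    also have "\<dots> = (\<bar>L\<bar> / K) * dist u v"
      by (simp add: exp_minus field_simps)
    also have "\<dots> \<le> (1/2) * dist u v"
      by (intro mult_right_mono) (auto simp: K_def field_simps)
    finally show "dist (\<Phi> u t) (\<Phi> v t) \<le> (1/2) * dist u v" .
  qed
  then obtain u where u: "\<Phi> u = u"
    using banach_fix_type[of "1/2" \<Phi>] by auto
  let ?u = "apply_bcontfun u"
  have uF: "?u t = F ?u t" for t using \<Phi>[of u] u by simp
  show ?thesis
  proof (intro exI[of _ "I ?u"] conjI ballI)
    fix t assume t: "t \<in> {-S..S}"
    have "exp (K * \<bar>t\<bar>) *\<^sub>R ?u t = I ?u t"
      by (subst uF) (simp add: F_def c_id[OF t] exp_minus)
    then show "(I ?u has_vector_derivative G t (I ?u t)) (at t within {-S..S})"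
      using I_deriv[of ?u t] t by (simp add: h_def)
  qed (simp add: I_def)
qed

text \<open>Both differentiability results for the flow are reached through an error estimate of
  this quadratic shape.\<close>

lemma has_derivative_quadratic:
  fixes F :: "'a::real_normed_vector \<Rightarrow> 'b::real_normed_vector"
  assumes "bounded_linear A" "r > 0"
    and bnd: "\<And>x. x \<in> ball x0 r \<Longrightarrow> norm (F x - F x0 - A (x - x0)) \<le> c * (norm (x - x0))\<^sup>2"
  shows "(F has_derivative A) (at x0)"
proof (rule has_derivativeI_sandwich[OF assms(2)])
  show "((\<lambda>x. c * norm (x - x0)) \<longlongrightarrow> 0) (at x0)"
    by (auto intro!: tendsto_eq_intros)
  fix x assume x: "x \<noteq> x0" "dist x x0 < r"
  then have "norm (F x - F x0 - A (x - x0)) \<le> c * norm (x - x0) * norm (x - x0)"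
    using bnd[of x] by (simp add: dist_commute power2_eq_square mult.assoc)
  then show "norm (F x - F x0 - A (x - x0)) / norm (x - x0) \<le> c * norm (x - x0)"
    using x by (simp add: pos_divide_le_eq)
qed (rule assms(1))

subsection \<open>The flow and its derivative\<close>

lemma ivp_solutionD:
  assumes "ivp_solution f x J y"
  shows "open J" "is_interval J" "0 \<in> J" "y 0 = x"
    "\<And>t. t \<in> J \<Longrightarrow> (y has_vector_derivative f (y t)) (at t)"
  using assms by (auto simp: ivp_solution_def)

lemma ivp_solution_continuous_on:
  "ivp_solution f x J y \<Longrightarrow> A \<subseteq> J \<Longrightarrow> continuous_on A y"
  by (meson ivp_solutionD(5) continuous_at_imp_continuous_on has_vector_derivative_continuous subsetD)

lemma ivp_solution_interval:
  assumes "ivp_solution f x J y" "s \<in> J" "t \<in> J"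
  shows "{s..t} \<subseteq> J"
proof -
  have "closed_segment s t \<subseteq> J"
    using ivp_solutionD(2)[OF assms(1)] assms(2,3)
    by (intro closed_segment_subset) (simp_all add: is_interval_convex_1)
  then show ?thesis
    by (cases "s \<le> t") (simp_all add: closed_segment_eq_real_ivl)
qed

text \<open>The equation is autonomous: an orbit restarted at one of its points is the same orbit
  with shifted time.\<close>

lemma ivp_solution_shift:
  assumes "ivp_solution f x J y" "s \<in> J"
  shows "ivp_solution f (y s) ((\<lambda>t. t - s) ` J) (\<lambda>t. y (t + s))"
proof -
  note * = ivp_solutionD[OF assms(1)]
  have "((\<lambda>u. y (u + s)) has_vector_derivative f (y t)) (at (t - s))" if "t \<in> J" for t
  proof -
    have "((\<lambda>u. u + s) has_vector_derivative 1) (at (t - s))"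
      by (auto intro!: derivative_eq_intros)
    from vector_diff_chain_at[OF this, of y "f (y t)"] show ?thesis
      using *(5)[OF that] by (simp add: o_def)
  qed
  moreover have "open ((\<lambda>t. t - s) ` J)"
    using open_translation_subtract[OF *(1)] by simp
  ultimately show ?thesis
    unfolding ivp_solution_def using * assms(2) by auto
qed

text \<open>On \<open>{0..t}\<close> both solutions stay in one ball, where \<open>f\<close> is
  Lipschitz; Gronwall's inequality for their difference, which starts at 0, makes it vanish.\<close>

lemma ivp_solution_unique:
  fixes f :: "'a::euclidean_space \<Rightarrow> 'a"
  assumes f: "smooth_on UNIV f"
    and y: "ivp_solution f x J y" "t \<in> J" and z: "ivp_solution f x K z" "t \<in> K" and t: "t \<ge> 0"
  shows "y t = z t"
proof -
  have sub: "{0..t} \<subseteq> J" "{0..t} \<subseteq> K"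
    using ivp_solution_interval[OF y(1) ivp_solutionD(3)[OF y(1)] y(2)]
      ivp_solution_interval[OF z(1) ivp_solutionD(3)[OF z(1)] z(2)] .
  have "bounded (y ` {0..t} \<union> z ` {0..t})"
    by (intro iffD2[OF bounded_Un] conjI compact_imp_bounded compact_continuous_image
        ivp_solution_continuous_on[OF y(1)] ivp_solution_continuous_on[OF z(1)] sub) auto
  then obtain R where "\<forall>u\<in>y ` {0..t} \<union> z ` {0..t}. norm u \<le> R"
    unfolding bounded_iff by blast
  then have R: "y s \<in> cball 0 R" "z s \<in> cball 0 R" if "s \<in> {0..t}" for s
    using that by auto
  obtain L where L: "L \<ge> 0"
    "\<forall>u\<in>cball 0 R. \<forall>v\<in>cball 0 R. norm (f u - f v) \<le> L * norm (u - v)"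
    using smooth_on_lipschitz[OF f subset_UNIV compact_cball[of 0 R] convex_cball] by (elim exE conjE)
  have "norm (y t - z t) \<le> (norm (y 0 - z 0) + 0 * (1 + t)) * exp ((L + 1) * t)"
  proof (rule gronwall_forward[where z' = "\<lambda>s. f (y s) - f (z s)"])
    fix s assume s: "s \<in> {0..t}"
    show "((\<lambda>s. y s - z s) has_vector_derivative f (y s) - f (z s)) (at s within {0..t})"
      using s sub
      by (intro has_vector_derivative_diff has_vector_derivative_at_within[OF ivp_solutionD(5)[OF y(1)]]
          has_vector_derivative_at_within[OF ivp_solutionD(5)[OF z(1)]]) auto
    show "norm (f (y s) - f (z s)) \<le> L * norm (y s - z s) + 0"
      using L(2) R[OF s] by simp
  qed (use L t in auto)
  then show ?thesis
    using ivp_solutionD(4)[OF y(1)] ivp_solutionD(4)[OF z(1)] by simp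
qed

text \<open>Uniqueness resolves the definite description: any one solution defined at
  \<open>t\<close> computes the flow.\<close>

lemma flow_eq:
  fixes f :: "'a::euclidean_space \<Rightarrow> 'a"
  assumes f: "smooth_on UNIV f" and y: "ivp_solution f x J y" "t \<in> J" "t \<ge> 0"
  shows "flow f t x = y t"
  unfolding flow_def
proof (rule the_equality)
  show "\<exists>J y'. ivp_solution f x J y' \<and> t \<in> J \<and> y' t = y t"
    using y by (intro exI[of _ J] exI[of _ y]) simp
  show "z = y t" if "\<exists>J y. ivp_solution f x J y \<and> t \<in> J \<and> y t = z" for z
  proof -
    from that obtain K w where w: "ivp_solution f x K w" "t \<in> K" "w t = z" by blast
    show ?thesis using ivp_solution_unique[OF f w(1,2) y] w(3) by simp
  qed
qed

text \<open>Two-sided derivatives at the end points of \<open>{0..T}\<close> and return times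
  slightly larger than \<open>T\<close> need room on both sides.\<close>

lemma ivp_solution_margin:
  assumes "ivp_solution f x J y" "T \<in> J"
  obtains \<delta> where "\<delta> > 0" "{-\<delta>..T + \<delta>} \<subseteq> J"
proof -
  note * = ivp_solutionD[OF assms(1)]
  obtain d1 where d1: "d1 > 0" "cball 0 d1 \<subseteq> J"
    using *(3) open_contains_cball_eq[OF *(1)] by blast
  obtain d2 where d2: "d2 > 0" "cball T d2 \<subseteq> J"
    using assms(2) open_contains_cball_eq[OF *(1)] by blast
  define \<delta> where "\<delta> = min d1 d2"
  have \<delta>: "\<delta> > 0" "\<delta> \<le> d1" "\<delta> \<le> d2"
    using d1 d2 by (simp_all add: \<delta>_def)
  have "-\<delta> \<in> J"
    using \<delta> by (intro subsetD[OF d1(2)]) (simp add: dist_real_def)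
  moreover have "T + \<delta> \<in> J"
    using \<delta> by (intro subsetD[OF d2(2)]) (simp add: dist_real_def)
  ultimately have "{-\<delta>..T + \<delta>} \<subseteq> J"
    by (rule ivp_solution_interval[OF assms(1)])
  with \<delta>(1) show ?thesis by (rule that)
qed

text \<open>Composing \<open>f\<close> with the projection onto a large ball makes it globally Lipschitz without
  changing it near the given orbit.\<close>

lemma neighbouring_solutions:
  fixes f :: "'a::euclidean_space \<Rightarrow> 'a"
  assumes f: "smooth_on UNIV f" and y: "ivp_solution f x0 J y" and T: "T \<in> J" "T \<ge> 0"
  shows "\<exists>\<psi> \<delta> r R E. \<delta> > 0 \<and> r > 0 \<and> (\<forall>x\<in>ball x0 r.
    ivp_solution f x {-\<delta><..<T + \<delta>} (\<psi> x) \<and>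
    (\<forall>t\<in>{-\<delta><..<T + \<delta>}. norm (\<psi> x t) \<le> R \<and>
       norm (\<psi> x t - \<psi> x0 t) \<le> E * norm (x - x0)))"
proof -
  obtain \<delta> where \<delta>: "\<delta> > 0" "{-\<delta>..T + \<delta>} \<subseteq> J"
    by (rule ivp_solution_margin[OF y T(1)])
  let ?I = "{-\<delta>..T + \<delta>}"
  have "bounded (y ` ?I)"
    by (intro compact_imp_bounded compact_continuous_image ivp_solution_continuous_on[OF y] \<delta>) auto
  then obtain R0 where R0: "R0 > 0" "\<And>t. t \<in> ?I \<Longrightarrow> norm (y t) \<le> R0"
    unfolding bounded_pos by blast
  \<comment> \<open>The extra unit is the slack in which neighbouring solutions may move before the
    truncation is felt.\<close>
  define C where "C = cball (0::'a) (R0 + 1)"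
  have C: "compact C" "convex C" "closed C" "C \<noteq> {}"
    using R0 by (auto simp: C_def)
  obtain L where L: "L \<ge> 0" "\<forall>u\<in>C. \<forall>v\<in>C. norm (f u - f v) \<le> L * norm (u - v)"
    using smooth_on_lipschitz[OF f subset_UNIV C(1,2)] by (elim exE conjE)
  define g where "g x = f (closest_point C x)" for x
  have g_eq: "g x = f x" if "x \<in> C" for x
    using that by (simp add: g_def closest_point_self)
  have g_lip: "norm (g u - g v) \<le> L * norm (u - v)" for u v
  proof -
    have "norm (g u - g v) \<le> L * norm (closest_point C u - closest_point C v)"
      unfolding g_def using L(2) closest_point_in_set C by blast
    also have "\<dots> \<le> L * norm (u - v)"
      using closest_point_lipschitz[OF C(2-4), of u v] L(1)
      by (intro mult_left_mono) (auto simp: dist_norm)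
    finally show ?thesis .
  qed
  have g_cont: "continuous_on UNIV g"
    unfolding g_def
    by (intro continuous_on_compose2[OF smooth_on_continuous_on[OF f]] continuous_on_closest_point C) auto
  have "\<exists>z. z 0 = x \<and> (\<forall>t\<in>?I. (z has_vector_derivative g (z t)) (at t within ?I))" for x
  proof -
    \<comment> \<open>\<open>global_picard\<close> works on intervals symmetric about 0; this one
      contains \<open>?I\<close>.\<close>
    have "continuous_on ({-(T+\<delta>)..T+\<delta>} \<times> UNIV) (\<lambda>(t::real, x). g x)"
      unfolding split_beta by (intro continuous_on_compose2[OF g_cont] continuous_intros) auto
    moreover have "T + \<delta> > 0" using T \<delta> by simp
    ultimately obtain z where z: "z 0 = x"
      "\<forall>t\<in>{-(T+\<delta>)..T+\<delta>}. (z has_vector_derivative g (z t)) (at t within {-(T+\<delta>)..T+\<delta>})"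
      using global_picard[where G = "\<lambda>_. g" and S = "T + \<delta>", OF _ _ g_lip] by blast
    have "(z has_vector_derivative g (z t)) (at t within ?I)" if "t \<in> ?I" for t
      by (rule has_vector_derivative_within_subset[OF bspec[OF z(2)]]) (use that T in auto)
    with z(1) show ?thesis by blast
  qed
  then obtain \<psi> where \<psi>0: "\<And>x. \<psi> x 0 = x"
    and \<psi>: "\<And>x t. t \<in> ?I \<Longrightarrow> (\<psi> x has_vector_derivative g (\<psi> x t)) (at t within ?I)"
    by metis
  define E where "E = exp ((L + 1) * (T + \<delta> - -\<delta>))"
  have dist_le: "norm (z t - w t) \<le> E * norm (z 0 - w 0)"
    if z: "\<And>s. s \<in> ?I \<Longrightarrow> (z has_vector_derivative g (z s)) (at s within ?I)"
      and w: "\<And>s. s \<in> ?I \<Longrightarrow> (w has_vector_derivative g (w s)) (at s within ?I)"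
      and t: "t \<in> ?I" for z w t
  proof -
    have "norm (z t - w t) \<le> norm (z 0 - w 0) * E"
      unfolding E_def
      by (rule gronwall[where z' = "\<lambda>s. g (z s) - g (w s)"])
        (use z w g_lip L(1) T \<delta> t in \<open>auto intro!: has_vector_derivative_diff\<close>)
    then show ?thesis by (simp add: mult.commute)
  qed
  \<comment> \<open>The given orbit stays in \<open>C\<close> on \<open>?I\<close>, so it also
    solves the truncated equation.\<close>
  have y_eq: "\<psi> x0 t = y t" if t: "t \<in> ?I" for t
  proof -
    have "norm (\<psi> x0 t - y t) \<le> E * norm (\<psi> x0 0 - y 0)"
    proof (rule dist_le[OF \<psi> _ t])
      fix s assume s: "s \<in> ?I"
      then have "y s \<in> C" using R0(2)[OF s] by (simp add: C_def)
      moreover have "s \<in> J" using s \<delta>(2) by blast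
      ultimately show "(y has_vector_derivative g (y s)) (at s within ?I)"
        using has_vector_derivative_at_within[OF ivp_solutionD(5)[OF y]] by (simp add: g_eq)
    qed
    then show ?thesis using \<psi>0 ivp_solutionD(4)[OF y] by simp
  qed
  have close: "norm (\<psi> x t - \<psi> x0 t) \<le> E * norm (x - x0)" if "t \<in> ?I" for x t
    using dist_le[OF \<psi> \<psi> that] \<psi>0 by simp
  \<comment> \<open>Deviations grow at most by the factor \<open>E\<close>, so a start within
    \<open>1 / E\<close> of \<open>x0\<close> keeps the solution within 1 of the orbit, hence in
    \<open>C\<close>, where \<open>g\<close> and \<open>f\<close> agree.\<close>
  define r where "r = 1 / E"
  have E: "E > 0" by (simp add: E_def)
  have in_C: "\<psi> x t \<in> C" if x: "x \<in> ball x0 r" and t: "t \<in> ?I" for x t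
  proof -
    have "norm (\<psi> x t - \<psi> x0 t) \<le> E * norm (x - x0)" by (rule close[OF t])
    also have "\<dots> \<le> E * r" using x E by (intro mult_left_mono) (auto simp: dist_norm norm_minus_commute)
    also have "\<dots> = 1" using E by (simp add: r_def)
    finally have "norm (\<psi> x t - y t) \<le> 1" by (simp add: y_eq[OF t])
    then have "norm (\<psi> x t) \<le> R0 + 1"
      using R0(2)[OF t] norm_triangle_sub[of "\<psi> x t" "y t"] by linarith
    then show ?thesis by (simp add: C_def)
  qed
  show ?thesis
  proof (rule exI[of _ \<psi>], rule exI[of _ \<delta>], rule exI[of _ r], rule exI[of _ "R0 + 1"],
      rule exI[of _ E], intro conjI ballI)
    fix x assume x: "x \<in> ball x0 r"
    have "(\<psi> x has_vector_derivative f (\<psi> x t)) (at t)" if t: "t \<in> {-\<delta><..<T + \<delta>}" for t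
    proof -
      have tI: "t \<in> ?I" using t by auto
      have "(\<psi> x has_vector_derivative g (\<psi> x t)) (at t within {-\<delta><..<T + \<delta>})"
        by (rule has_vector_derivative_within_subset[OF \<psi>[OF tI]]) auto
      then show ?thesis
        unfolding has_vector_derivative_within_open[OF t open_greaterThanLessThan] g_eq[OF in_C[OF x tI]] .
    qed
    then show "ivp_solution f x {-\<delta><..<T + \<delta>} (\<psi> x)"
      using \<psi>0 T \<delta> by (simp add: ivp_solution_def is_interval_convex_1)
    fix t assume t: "t \<in> {-\<delta><..<T + \<delta>}"
    then show "norm (\<psi> x t - \<psi> x0 t) \<le> E * norm (x - x0)" by (intro close) auto
    show "norm (\<psi> x t) \<le> R0 + 1" using in_C[OF x, of t] t by (simp add: C_def)
  qed (use \<delta> E in \<open>simp_all add: r_def\<close>)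
qed

text \<open>Smoothness yields continuity in the base point for a fixed direction; expanding
  \<open>w\<close> in the basis gives the joint continuity that Picard's theorem asks for.\<close>

lemma continuous_on_derivative_apply:
  fixes f :: "'a::euclidean_space \<Rightarrow> 'b::real_normed_vector"
  assumes f: "smooth_on UNIV f" and p: "continuous_on I p"
  shows "continuous_on (I \<times> UNIV) (\<lambda>(t, w). frechet_derivative f (at (p t)) w)"
proof -
  have sum: "frechet_derivative f (at x) w = (\<Sum>b\<in>Basis. (w \<bullet> b) *\<^sub>R frechet_derivative f (at x) b)" for x w
  proof -
    have "linear (frechet_derivative f (at x))"
      using smooth_on_bounded_linear_derivative[OF f] bounded_linear.linear by blast
    then show ?thesis
      by (subst euclidean_representation[of w, symmetric]) (simp add: linear_sum linear_scale)
  qed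
  have "(\<lambda>(t, w). frechet_derivative f (at (p t)) w)
      = (\<lambda>q. \<Sum>b\<in>Basis. (snd q \<bullet> b) *\<^sub>R frechet_derivative f (at (p (fst q))) b)"
    unfolding split_beta by (rule ext) (rule sum)
  moreover have "continuous_on (I \<times> UNIV) (\<lambda>q. \<Sum>b\<in>Basis.
      (snd q \<bullet> b) *\<^sub>R frechet_derivative f (at (p (fst q))) b)"
    by (intro continuous_intros
        continuous_on_compose2[OF smooth_on_continuous_on[OF smooth_on_frechet_derivative[OF f]]]
        continuous_on_compose2[OF p]) auto
  ultimately show ?thesis
    by (simp only:)
qed

text \<open>The derivative is the solution operator of the variational equation
  \<open>w' = frechet_derivative f (at (\<psi> x0 t)) w\<close>.\<close>

lemma solution_has_derivative_initial_value:
  fixes f :: "'a::euclidean_space \<Rightarrow> 'a"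
  assumes f: "smooth_on UNIV f" and r: "r > 0" and T: "T > 0"
    and sol: "\<And>x. x \<in> ball x0 r \<Longrightarrow> ivp_solution f x J (\<psi> x)" and J: "{0..T} \<subseteq> J"
    and bnd: "\<And>x t. x \<in> ball x0 r \<Longrightarrow> t \<in> J \<Longrightarrow> norm (\<psi> x t) \<le> R"
    and close: "\<And>x t. x \<in> ball x0 r \<Longrightarrow> t \<in> J \<Longrightarrow> norm (\<psi> x t - \<psi> x0 t) \<le> E * norm (x - x0)"
  shows "\<exists>A. ((\<lambda>x. \<psi> x T) has_derivative A) (at x0)"
proof -
  define C where "C = cball (0::'a) R"
  have C: "compact C" "convex C" by (simp_all add: C_def)
  have x0: "x0 \<in> ball x0 r" using r by simp
  have in_C: "\<psi> x t \<in> C" if "x \<in> ball x0 r" "t \<in> {0..T}" for x t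
    using bnd[OF that(1), of t] that(2) J by (simp add: C_def subset_iff)
  let ?D = "\<lambda>x. frechet_derivative f (at x)"
  have bl: "bounded_linear (?D x)" for x
    by (rule smooth_on_bounded_linear_derivative[OF f UNIV_I])
  obtain B where B: "B \<ge> 0" "\<forall>x\<in>C. onorm (?D x) \<le> B"
    using smooth_on_derivative_bound[OF f subset_UNIV C(1)] by (elim exE conjE)
  have D_bnd: "norm (?D x w) \<le> B * norm w" if "x \<in> C" for x w
    using onorm[OF bl, of x w] mult_right_mono[OF bspec[OF B(2) that], of "norm w"] by simp
  obtain K where K: "K \<ge> 0"
    "\<forall>x\<in>C. \<forall>y\<in>C. norm (f y - f x - ?D x (y - x)) \<le> K * (norm (y - x))\<^sup>2"
    using smooth_on_taylor[OF f subset_UNIV C] by (elim exE conjE)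
  have der: "(\<psi> x has_vector_derivative f (\<psi> x t)) (at t within {0..T})"
    if "x \<in> ball x0 r" "t \<in> {0..T}" for x t
    by (rule has_vector_derivative_at_within[OF ivp_solutionD(5)[OF sol[OF that(1)]]])
      (use that(2) J in blast)
  have "\<exists>w. w 0 = v \<and>
      (\<forall>t\<in>{0..T}. (w has_vector_derivative ?D (\<psi> x0 t) (w t)) (at t within {0..T}))" for v
  proof -
    \<comment> \<open>The reference orbit is frozen at its initial value for negative times, because
      \<open>global_picard\<close> wants a field on all of \<open>{-T..T}\<close>.\<close>
    define p where "p t = \<psi> x0 (max 0 t)" for t
    have "continuous_on {-T..T} p"
      unfolding p_def
      by (rule continuous_on_compose2[OF ivp_solution_continuous_on[OF sol[OF x0] J]])
        (use T in \<open>auto intro!: continuous_intros\<close>)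
    then have cont: "continuous_on ({-T..T} \<times> UNIV) (\<lambda>(t, w). ?D (p t) w)"
      by (rule continuous_on_derivative_apply[OF f])
    have lip: "norm (?D (p t) u - ?D (p t) w) \<le> B * norm (u - w)" if "t \<in> {-T..T}" for t u w
    proof -
      have "?D (p t) u - ?D (p t) w = ?D (p t) (u - w)"
        using linear_diff[OF bounded_linear.linear[OF bl]] by metis
      moreover have "p t \<in> C" unfolding p_def by (rule in_C[OF x0]) (use that T in auto)
      ultimately show ?thesis using D_bnd by metis
    qed
    obtain w where w: "w 0 = v"
      "\<forall>t\<in>{-T..T}. (w has_vector_derivative ?D (p t) (w t)) (at t within {-T..T})"
      using global_picard[OF T cont lip] by blast
    have "(w has_vector_derivative ?D (\<psi> x0 t) (w t)) (at t within {0..T})" if t: "t \<in> {0..T}" for t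
    proof -
      have "(w has_vector_derivative ?D (p t) (w t)) (at t within {0..T})"
        by (rule has_vector_derivative_within_subset[OF bspec[OF w(2)]]) (use t in auto)
      then show ?thesis using t by (simp add: p_def)
    qed
    with w(1) show ?thesis by blast
  qed
  then obtain W where W0: "\<And>v. W v 0 = v" and W: "\<And>v t. t \<in> {0..T} \<Longrightarrow>
      (W v has_vector_derivative ?D (\<psi> x0 t) (W v t)) (at t within {0..T})"
    by metis
  \<comment> \<open>Uniqueness for the variational equation. Applied to the combinations below, it
    makes \<open>W v T\<close> linear in \<open>v\<close>.\<close>
  have zero: "z T = 0" if z: "\<And>t. t \<in> {0..T} \<Longrightarrow>
      (z has_vector_derivative ?D (\<psi> x0 t) (z t)) (at t within {0..T})" and z0: "z 0 = 0" for z
  proof -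
    have "norm (z T) \<le> (norm (z 0) + 0 * (1 + T)) * exp ((B + 1) * T)"
      by (rule gronwall_forward[OF z]) (use D_bnd in_C[OF x0] B(1) T in auto)
    then show ?thesis using z0 by simp
  qed
  note lin = bounded_linear.linear[OF bl]
  have "linear (\<lambda>v. W v T)"
  proof (rule linearI)
    fix u v
    have "W (u + v) T - W u T - W v T = 0"
    proof (rule zero)
      fix t assume t: "t \<in> {0..T}"
      show "((\<lambda>t. W (u + v) t - W u t - W v t) has_vector_derivative
          ?D (\<psi> x0 t) (W (u + v) t - W u t - W v t)) (at t within {0..T})"
        unfolding linear_diff[OF lin] by (intro has_vector_derivative_diff W t)
    qed (simp add: W0)
    then show "W (u + v) T = W u T + W v T" by (simp add: algebra_simps)
  next
    fix c :: real and v
    have "W (c *\<^sub>R v) T - c *\<^sub>R W v T = 0"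
    proof (rule zero)
      fix t assume t: "t \<in> {0..T}"
      show "((\<lambda>t. W (c *\<^sub>R v) t - c *\<^sub>R W v t) has_vector_derivative
          ?D (\<psi> x0 t) (W (c *\<^sub>R v) t - c *\<^sub>R W v t)) (at t within {0..T})"
        unfolding linear_diff[OF lin] linear_scale[OF lin]
        by (intro has_vector_derivative_diff W t
            bounded_linear.has_vector_derivative[OF bounded_linear_scaleR_right W[OF t]])
    qed (simp add: W0)
    then show "W (c *\<^sub>R v) T = c *\<^sub>R W v T" by simp
  qed
  then have A: "bounded_linear (\<lambda>v. W v T)"
    by (simp add: linear_conv_bounded_linear)
  define c where "c = K * E\<^sup>2 * (1 + T) * exp ((B + 1) * T)"
  have "((\<lambda>x. \<psi> x T) has_derivative (\<lambda>v. W v T)) (at x0)"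
  proof (rule has_derivative_quadratic[OF A r])
    fix x assume x: "x \<in> ball x0 r"
    \<comment> \<open>The error solves the variational equation up to the Taylor remainder of
      \<open>f\<close>, which \<open>close\<close> bounds by \<open>?e\<close>. It starts at 0, so
      Gronwall's inequality leaves only the quadratic term.\<close>
    let ?z = "\<lambda>t. \<psi> x t - \<psi> x0 t - W (x - x0) t"
    let ?e = "K * (E * norm (x - x0))\<^sup>2"
    have "norm (?z T) \<le> (norm (?z 0) + ?e * (1 + T)) * exp ((B + 1) * T)"
    proof (rule gronwall_forward)
      fix t assume t: "t \<in> {0..T}"
      show "(?z has_vector_derivative f (\<psi> x t) - f (\<psi> x0 t) - ?D (\<psi> x0 t) (W (x - x0) t))
          (at t within {0..T})"
        by (intro has_vector_derivative_diff der x x0 t W)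
      have "f (\<psi> x t) - f (\<psi> x0 t) - ?D (\<psi> x0 t) (W (x - x0) t)
          = ?D (\<psi> x0 t) (?z t) + (f (\<psi> x t) - f (\<psi> x0 t) - ?D (\<psi> x0 t) (\<psi> x t - \<psi> x0 t))"
        by (simp add: linear_diff[OF lin])
      also have "norm \<dots> \<le> norm (?D (\<psi> x0 t) (?z t))
          + norm (f (\<psi> x t) - f (\<psi> x0 t) - ?D (\<psi> x0 t) (\<psi> x t - \<psi> x0 t))"
        by (rule norm_triangle_ineq)
      also have "\<dots> \<le> B * norm (?z t) + K * (norm (\<psi> x t - \<psi> x0 t))\<^sup>2"
        by (intro add_mono D_bnd K(2)[rule_format] in_C x x0 t)
      also have "\<dots> \<le> B * norm (?z t) + ?e"
        using close[OF x, of t] t J K(1) by (intro add_left_mono mult_left_mono power_mono) auto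
      finally show "norm (f (\<psi> x t) - f (\<psi> x0 t) - ?D (\<psi> x0 t) (W (x - x0) t))
          \<le> B * norm (?z t) + ?e" .
    qed (use B K T in auto)
    moreover have "?z 0 = 0"
      using ivp_solutionD(4)[OF sol[OF x]] ivp_solutionD(4)[OF sol[OF x0]] W0 by simp
    ultimately show "norm (\<psi> x T - \<psi> x0 T - W (x - x0) T) \<le> c * (norm (x - x0))\<^sup>2"
      by (simp add: c_def power_mult_distrib algebra_simps)
  qed
  then show ?thesis by blast
qed

lemma vector_derivative_bound:
  fixes u :: "real \<Rightarrow> 'a::real_normed_vector"
  assumes "convex I" "a \<in> I" "b \<in> I"
    and u: "\<And>s. s \<in> I \<Longrightarrow> (u has_vector_derivative u' s) (at s within I)"
    and B: "\<And>s. s \<in> I \<Longrightarrow> norm (u' s) \<le> B"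
  shows "norm (u b - u a) \<le> B * \<bar>b - a\<bar>"
proof -
  have "norm (u b - u a) \<le> B * norm (b - a)"
  proof (rule differentiable_bound[OF assms(1) _ _ assms(3,2)])
    fix s assume s: "s \<in> I"
    show "(u has_derivative (\<lambda>h. h *\<^sub>R u' s)) (at s within I)"
      using u[OF s] by (simp add: has_vector_derivative_def)
    show "onorm (\<lambda>h. h *\<^sub>R u' s) \<le> B"
      by (intro onorm_le) (simp add: mult.commute[of B] mult_left_mono[OF B[OF s]])
  qed
  then show ?thesis by simp
qed

lemma flow_differentiable:
  fixes f :: "'a::euclidean_space \<Rightarrow> 'a"
  assumes f: "smooth_on UNIV f" and y: "ivp_solution f x0 J y" and T: "T \<in> J" "T > 0"
  shows "flow f T differentiable (at x0)"
proof -
  obtain \<psi> \<delta> r R E where \<delta>: "\<delta> > 0" and r: "r > 0"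
    and sol: "\<And>x. x \<in> ball x0 r \<Longrightarrow> ivp_solution f x {-\<delta><..<T + \<delta>} (\<psi> x)"
    and bnd: "\<And>x t. x \<in> ball x0 r \<Longrightarrow> t \<in> {-\<delta><..<T + \<delta>} \<Longrightarrow> norm (\<psi> x t) \<le> R"
    and close: "\<And>x t. x \<in> ball x0 r \<Longrightarrow> t \<in> {-\<delta><..<T + \<delta>} \<Longrightarrow>
       norm (\<psi> x t - \<psi> x0 t) \<le> E * norm (x - x0)"
    using neighbouring_solutions[OF f y T(1) less_imp_le[OF T(2)]] by blast
  have sub: "{0..T} \<subseteq> {-\<delta><..<T + \<delta>}" using \<delta> by auto
  obtain A where "((\<lambda>x. \<psi> x T) has_derivative A) (at x0)"
    using solution_has_derivative_initial_value[OF f r T(2) sol sub bnd close] by blast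
  moreover have "\<psi> x T = flow f T x" if "x \<in> ball x0 r" for x
    by (rule flow_eq[OF f sol[OF that], symmetric]) (use T(2) \<delta> in auto)
  ultimately have "(flow f T has_derivative A) (at x0)"
    using r has_derivative_transform_within_open[OF _ open_ball, of "\<lambda>x. \<psi> x T" A x0 UNIV x0 r]
    by simp
  then show ?thesis by (rule differentiableI)
qed

text \<open>For small \<open>s\<close> of either sign, \<open>flow f T (y s) = y (T + s)\<close>;
  the two sides have derivatives \<open>A (f x0)\<close> and \<open>f (y T)\<close> at 0.\<close>

lemma flow_derivative_along_orbit:
  fixes f :: "'a::euclidean_space \<Rightarrow> 'a"
  assumes f: "smooth_on UNIV f" and y: "ivp_solution f x0 J y" and T: "T \<in> J" "T > 0"
    and A: "(flow f T has_derivative A) (at x0)"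
  shows "A (f x0) = f (y T)"
proof -
  note * = ivp_solutionD[OF y]
  obtain \<delta> where \<delta>: "\<delta> > 0" "{-\<delta>..T + \<delta>} \<subseteq> J"
    by (rule ivp_solution_margin[OF y T(1)])
  have "flow f T (y s) = y (T + s)" if s: "s \<in> {-\<delta><..<\<delta>}" for s
  proof (rule flow_eq[OF f ivp_solution_shift[OF y]])
    show "s \<in> J" by (rule subsetD[OF \<delta>(2)]) (use s T in auto)
    have "T + s \<in> J" by (rule subsetD[OF \<delta>(2)]) (use s T in auto)
    then show "T \<in> (\<lambda>t. t - s) ` J" by (intro image_eqI[of _ _ "T + s"]) simp_all
  qed (use T in simp)
  moreover have "((flow f T \<circ> y) has_vector_derivative A (f x0)) (at 0)"
    using vector_derivative_diff_chain_within[of y "f x0" 0 UNIV "flow f T" A]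
      *(3,4) *(5)[OF *(3)] has_derivative_at_withinI[OF A] by simp
  ultimately have "((\<lambda>s. y (T + s)) has_vector_derivative A (f x0)) (at 0)"
    using \<delta>(1) has_vector_derivative_transform_within_open[OF _ open_greaterThanLessThan,
        of "flow f T \<circ> y" "A (f x0)" 0 "-\<delta>" \<delta> "\<lambda>s. y (T + s)"] by simp
  moreover have "((\<lambda>s. y (T + s)) has_vector_derivative f (y T)) (at 0)"
  proof -
    have "((\<lambda>s. T + s) has_vector_derivative 1) (at 0)"
      by (auto intro!: derivative_eq_intros)
    from vector_diff_chain_at[OF this, of y "f (y T)"] show ?thesis
      using *(5)[OF T(1)] by (simp add: o_def)
  qed
  ultimately show ?thesis by (rule vector_derivative_unique_at)
qed

text \<open>This avoids joint differentiability in time and position. Passing from time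
  \<open>T\<close> to \<open>tau x\<close> moves the point by
  \<open>(tau x - T) *\<^sub>R f (y T)\<close> up to the error \<open>Q\<close>, which is quadratic
  because the elapsed time and the deviation of the velocity from \<open>f (y T)\<close> are both of
  first order.\<close>

lemma flow_variable_time_has_derivative:
  fixes f :: "'a::euclidean_space \<Rightarrow> 'a"
  assumes f: "smooth_on UNIV f" and y: "ivp_solution f x0 J y" and T: "T \<in> J" "T > 0"
    and A: "(flow f T has_derivative A) (at x0)"
    and U: "open U" "x0 \<in> U" and tau: "smooth_on U tau" "tau x0 = T"
  shows "((\<lambda>x. flow f (tau x) x) has_derivative
    (\<lambda>h. A h + frechet_derivative tau (at x0) h *\<^sub>R f (y T))) (at x0)"
proof -
  obtain \<psi> \<delta> r R E where \<delta>: "\<delta> > 0" and r: "r > 0"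
    and sol: "\<And>x. x \<in> ball x0 r \<Longrightarrow> ivp_solution f x {-\<delta><..<T + \<delta>} (\<psi> x)"
    and bnd: "\<And>x t. x \<in> ball x0 r \<Longrightarrow> t \<in> {-\<delta><..<T + \<delta>} \<Longrightarrow> norm (\<psi> x t) \<le> R"
    and close: "\<And>x t. x \<in> ball x0 r \<Longrightarrow> t \<in> {-\<delta><..<T + \<delta>} \<Longrightarrow>
       norm (\<psi> x t - \<psi> x0 t) \<le> E * norm (x - x0)"
    using neighbouring_solutions[OF f y T(1) less_imp_le[OF T(2)]] by blast
  let ?I = "{-\<delta><..<T + \<delta>}"
  have x0: "x0 \<in> ball x0 r" using r by simp
  have TI: "T \<in> ?I" using T \<delta> by auto
  have flow: "flow f t x = \<psi> x t" if "x \<in> ball x0 r" "t \<in> ?I" "t \<ge> 0" for x t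
    by (rule flow_eq[OF f sol[OF that(1)] that(2,3)])
  have yT: "\<psi> x0 T = y T"
    by (rule ivp_solution_unique[OF f sol[OF x0] TI y T(1)]) (use T in simp)
  define C where "C = cball (0::'a) R"
  have C: "compact C" "convex C" by (simp_all add: C_def)
  have in_C: "\<psi> x t \<in> C" if "x \<in> ball x0 r" "t \<in> ?I" for x t
    using bnd[OF that] by (simp add: C_def)
  obtain L where L: "L \<ge> 0" "\<forall>u\<in>C. \<forall>v\<in>C. norm (f u - f v) \<le> L * norm (u - v)"
    using smooth_on_lipschitz[OF f subset_UNIV C] by (elim exE conjE)
  have "bounded (f ` C)"
    by (rule compact_imp_bounded[OF compact_continuous_image[OF
        continuous_on_subset[OF smooth_on_continuous_on[OF f] subset_UNIV] C(1)]])
  then obtain B where B: "B > 0" "\<forall>u\<in>C. norm (f u) \<le> B"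
    unfolding bounded_pos by auto
  have der: "(\<psi> x has_vector_derivative f (\<psi> x t)) (at t within I)"
    if "x \<in> ball x0 r" "t \<in> ?I" for x t I
    by (rule has_vector_derivative_at_within[OF ivp_solutionD(5)[OF sol[OF that(1)] that(2)]])
  obtain q where q: "q > 0" "cball x0 q \<subseteq> U"
    using U open_contains_cball_eq by blast
  obtain K where K: "K \<ge> 0"
    "\<forall>u\<in>cball x0 q. \<forall>v\<in>cball x0 q. norm (tau u - tau v) \<le> K * norm (u - v)"
    using smooth_on_lipschitz[OF tau(1) q(2) compact_cball convex_cball] by (elim exE conjE)
  \<comment> \<open>Within this radius \<open>tau x\<close> differs from \<open>T\<close> by less
    than \<open>T\<close> and \<open>\<delta>\<close>, so it is a nonnegative time in
    \<open>?I\<close>; \<open>K + 1\<close> avoids a division by zero.\<close>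
  define p where "p = min (min r q) (min T \<delta> / (K + 1))"
  have p: "p > 0" "p \<le> r" "p \<le> q" "p \<le> min T \<delta> / (K + 1)"
    using r q T \<delta> K by (auto simp: p_def)
  define k where "k = f (y T)"
  define Q where "Q x = flow f (tau x) x - flow f T x - (tau x - T) *\<^sub>R k" for x
  define c where "c = L * (E + B * K) * K"
  have "(Q has_derivative (\<lambda>h. 0)) (at x0)"
  proof (rule has_derivative_quadratic[OF bounded_linear_zero p(1)])
    fix x assume x: "x \<in> ball x0 p"
    then have xr: "x \<in> ball x0 r" and xq: "x \<in> cball x0 q" and xp: "norm (x - x0) < p"
      using p by (auto simp: dist_norm norm_minus_commute)
    let ?n = "norm (x - x0)"
    have tau_le: "\<bar>tau x - T\<bar> \<le> K * ?n"
      using K(2)[rule_format, OF xq, of x0] q(1) tau(2) by simp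
    also have "\<dots> \<le> (K + 1) * ?n" by (intro mult_right_mono) auto
    also have "\<dots> < (K + 1) * p" using xp K(1) by (intro mult_strict_left_mono) auto
    also have "\<dots> \<le> min T \<delta>" using p(4) K(1) by (simp add: pos_le_divide_eq mult.commute)
    finally have tau_lt: "\<bar>tau x - T\<bar> < min T \<delta>" .
    then have tauI: "tau x \<in> ?I" "tau x \<ge> 0" using T \<delta> by auto
    let ?S = "closed_segment T (tau x)"
    have S: "?S \<subseteq> ?I" using TI tauI(1) by (intro closed_segment_subset) auto
    \<comment> \<open>With \<open>s *\<^sub>R k\<close> subtracted, the remaining velocity is
      \<open>f (\<psi> x s) - k\<close>. It is bounded through the distance between the two orbits
      plus the drift of the reference orbit since time \<open>T\<close>.\<close>
    have "norm ((\<psi> x (tau x) - tau x *\<^sub>R k) - (\<psi> x T - T *\<^sub>R k))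
        \<le> (L * (E * ?n + B * (K * ?n))) * \<bar>tau x - T\<bar>"
    proof (rule vector_derivative_bound[where I = ?S])
      fix s assume s: "s \<in> ?S"
      then have sI: "s \<in> ?I" using S by blast
      show "((\<lambda>s. \<psi> x s - s *\<^sub>R k) has_vector_derivative f (\<psi> x s) - k) (at s within ?S)"
        by (intro has_vector_derivative_diff der xr sI) (auto intro!: derivative_eq_intros)
      have "norm (\<psi> x0 s - \<psi> x0 T) \<le> B * \<bar>s - T\<bar>"
        by (rule vector_derivative_bound[OF convex_real_interval(8) TI sI der[OF x0]])
          (use B(2) in_C[OF x0] in auto)
      also have "\<dots> \<le> B * (K * ?n)"
        using segment_bound(1)[OF s] tau_le B(1) by (intro mult_left_mono) auto
      finally have "norm (\<psi> x s - \<psi> x0 T) \<le> E * ?n + B * (K * ?n)"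
        using close[OF xr sI] norm_triangle_ineq[of "\<psi> x s - \<psi> x0 s" "\<psi> x0 s - \<psi> x0 T"] by simp
      moreover have "norm (f (\<psi> x s) - k) \<le> L * norm (\<psi> x s - \<psi> x0 T)"
        unfolding k_def yT[symmetric] by (intro L(2)[rule_format] in_C xr sI x0 TI)
      ultimately show "norm (f (\<psi> x s) - k) \<le> L * (E * ?n + B * (K * ?n))"
        using mult_left_mono[OF _ L(1)] order_trans by blast
    qed simp_all
    also have "\<dots> \<le> (L * (E * ?n + B * (K * ?n))) * (K * ?n)"
    proof (rule mult_left_mono[OF tau_le])
      \<comment> \<open>No sign of \<open>E\<close> is assumed; the product is nonnegative because
        it bounds a norm.\<close>
      have "0 \<le> E * ?n" using close[OF xr TI] norm_ge_zero order_trans by blast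
      then show "0 \<le> L * (E * ?n + B * (K * ?n))" using L(1) B(1) K(1) by simp
    qed
    finally have "norm (\<psi> x (tau x) - \<psi> x T - (tau x - T) *\<^sub>R k) \<le> c * ?n\<^sup>2"
      by (simp add: c_def algebra_simps power2_eq_square)
    then show "norm (Q x - Q x0 - 0) \<le> c * (norm (x - x0))\<^sup>2"
      using flow[OF xr tauI] flow[OF xr TI] T tau(2) by (simp add: Q_def)
  qed
  moreover have "(tau has_derivative frechet_derivative tau (at x0)) (at x0)"
    by (rule smooth_on_has_derivative[OF tau(1) U(2)])
  ultimately have "((\<lambda>x. Q x + (flow f T x + (tau x - T) *\<^sub>R k)) has_derivative
      (\<lambda>h. 0 + (A h + (frechet_derivative tau (at x0) h - 0) *\<^sub>R k))) (at x0)"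
    by (intro has_derivative_add A has_derivative_scaleR_left has_derivative_diff has_derivative_const)
  then show ?thesis by (simp add: Q_def k_def)
qed

subsection \<open>The tangent space of a level set\<close>

text \<open>A curve with velocity \<open>v\<close> in the level set is an integral curve of the field
  \<open>x \<mapsto> D\<alpha>(x)w \<cdot> v - D\<alpha>(x)v \<cdot> w\<close>, which is annihilated by \<open>D\<alpha>(x)\<close> at every \<open>x\<close>; here
  \<open>D\<alpha>(x0)w = 1\<close>.\<close>

lemma tangent_space_level_set:
  fixes \<alpha> :: "'a::euclidean_space \<Rightarrow> real"
  assumes \<alpha>: "smooth_on UNIV \<alpha>" and x0: "\<alpha> x0 = 0"
    and surj: "surj (frechet_derivative \<alpha> (at x0))"
  shows "tangent_space {x. \<alpha> x = 0} x0 = {v. frechet_derivative \<alpha> (at x0) v = 0}"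
proof (intro equalityI subsetI)
  let ?D = "\<lambda>x. frechet_derivative \<alpha> (at x)"
  have chain: "((\<lambda>t. \<alpha> (c t)) has_vector_derivative ?D (c t) v) (at t)"
    if "(c has_vector_derivative v) (at t)" for c v t
    using vector_derivative_diff_chain_within[of c v t UNIV \<alpha> "?D (c t)"] that
      has_derivative_at_withinI[OF smooth_on_has_derivative[OF \<alpha>, of "c t"]] by (simp add: o_def)
  {
    fix v assume "v \<in> tangent_space {x. \<alpha> x = 0} x0"
    then obtain e c where c: "e > 0" "c ` {-e<..<e} \<subseteq> {x. \<alpha> x = 0}" "c 0 = x0"
      "(c has_vector_derivative v) (at 0)"
      unfolding tangent_space_def by blast
    have "\<alpha> (c t) = 0" if "t \<in> {-e<..<e}" for t
      using c(2) that by blast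
    then have "((\<lambda>t. \<alpha> (c t)) has_vector_derivative 0) (at 0)"
      using c(1) has_vector_derivative_transform_within_open[OF has_vector_derivative_const[of 0]
          open_greaterThanLessThan, of 0 "-e" e "\<lambda>t. \<alpha> (c t)"] by simp
    then have "?D x0 v = 0"
      using vector_derivative_unique_at[OF chain[OF c(4)]] c(3) by simp
    then show "v \<in> {v. ?D x0 v = 0}" by simp
  }
  fix v assume "v \<in> {v. ?D x0 v = 0}"
  then have v: "?D x0 v = 0" by simp
  obtain w where w: "?D x0 w = 1" using surj by (metis surjD)
  define g where "g x = ?D x w *\<^sub>R v - ?D x v *\<^sub>R w" for x
  \<comment> \<open>\<open>g\<close> is Lipschitz on this ball; projecting onto it makes the field
    globally Lipschitz, as Picard's theorem requires.\<close>
  define C where "C = cball x0 1"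
  have C: "compact C" "convex C" "closed C" "C \<noteq> {}" by (simp_all add: C_def)
  have lin: "linear (?D x)" for x
    by (rule bounded_linear.linear[OF smooth_on_bounded_linear_derivative[OF \<alpha> UNIV_I]])
  have Dg: "?D x (g x) = 0" for x
    by (simp add: g_def linear_diff[OF lin] linear_scale[OF lin])
  have g_cont: "continuous_on UNIV g"
    unfolding g_def by (intro continuous_intros
        smooth_on_continuous_on[OF smooth_on_frechet_derivative[OF \<alpha>]])
  have "\<exists>L. L \<ge> 0 \<and> (\<forall>x\<in>C. \<forall>y\<in>C. norm (?D x u - ?D y u) \<le> L * norm (x - y))" for u
    by (rule smooth_on_lipschitz[OF smooth_on_frechet_derivative[OF \<alpha>] subset_UNIV C(1,2)])
  then obtain L where L0: "\<And>u. L u \<ge> 0"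
    and L: "\<And>u x y. x \<in> C \<Longrightarrow> y \<in> C \<Longrightarrow> norm (?D x u - ?D y u) \<le> L u * norm (x - y)"
    by metis
  define K where "K = L w * norm v + L v * norm w"
  have K0: "K \<ge> 0" by (simp add: K_def L0)
  have g_lip: "norm (g x - g y) \<le> K * norm (x - y)" if "x \<in> C" "y \<in> C" for x y
  proof -
    have "g x - g y = (?D x w - ?D y w) *\<^sub>R v - (?D x v - ?D y v) *\<^sub>R w"
      by (simp add: g_def algebra_simps)
    also have "norm \<dots> \<le> norm (?D x w - ?D y w) * norm v + norm (?D x v - ?D y v) * norm w"
      using norm_triangle_ineq4 by (metis norm_scaleR real_norm_def)
    also have "\<dots> \<le> (L w * norm (x - y)) * norm v + (L v * norm (x - y)) * norm w"
      by (intro add_mono mult_right_mono L that norm_ge_zero)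
    finally show ?thesis by (simp add: K_def algebra_simps)
  qed
  have "norm (g (closest_point C x) - g (closest_point C y)) \<le> K * norm (x - y)" for x y
  proof -
    have "norm (g (closest_point C x) - g (closest_point C y))
        \<le> K * norm (closest_point C x - closest_point C y)"
      by (intro g_lip closest_point_in_set C)
    also have "\<dots> \<le> K * norm (x - y)"
      using closest_point_lipschitz[OF C(2-4), of x y] K0
      by (intro mult_left_mono) (auto simp: dist_norm)
    finally show ?thesis .
  qed
  moreover have "continuous_on ({-1..1} \<times> UNIV) (\<lambda>(t::real, x). g (closest_point C x))"
    unfolding split_beta
    by (intro continuous_on_compose2[OF g_cont]
        continuous_on_compose2[OF continuous_on_closest_point[OF C(2-4), of UNIV]] continuous_intros) auto
  ultimately obtain c where c0: "c 0 = x0"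
    and c: "\<forall>t\<in>{-1..1}. (c has_vector_derivative g (closest_point C (c t))) (at t within {-1..1})"
    using global_picard[where S = 1 and G = "\<lambda>_ x. g (closest_point C x)"] zero_less_one by blast
  have c_der: "(c has_vector_derivative g (closest_point C (c t))) (at t)" if "t \<in> {-1<..<1}" for t
  proof -
    have "(c has_vector_derivative g (closest_point C (c t))) (at t within {-1<..<1})"
      by (rule has_vector_derivative_within_subset[OF bspec[OF c]]) (use that in auto)
    then show ?thesis
      unfolding has_vector_derivative_within_open[OF that open_greaterThanLessThan] .
  qed
  have c_cont: "continuous_on {-1<..<1} c"
    by (rule continuous_at_imp_continuous_on) (use c_der has_vector_derivative_continuous in blast)
  have "isCont c 0"
    by (rule has_vector_derivative_continuous[OF c_der]) simp
  then obtain d where d: "d > 0" "\<forall>t. dist t 0 < d \<longrightarrow> dist (c t) (c 0) < 1"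
    unfolding continuous_at_eps_delta by (metis zero_less_one)
  \<comment> \<open>Times so short that the curve is still in \<open>C\<close>, where the projection
    is the identity and \<open>c\<close> is an integral curve of \<open>g\<close> itself.\<close>
  define e where "e = min d 1"
  have e: "e > 0" "{-e<..<e} \<subseteq> {-1<..<1}" using d by (auto simp: e_def)
  have c_C: "c t \<in> C" if "t \<in> {-e<..<e}" for t
  proof -
    have "dist t 0 < d" using that by (auto simp: e_def dist_real_def)
    then show ?thesis
      using d(2) c0 by (auto simp: C_def dist_commute intro: less_imp_le)
  qed
  have c_g: "(c has_vector_derivative g (c t)) (at t)" if "t \<in> {-e<..<e}" for t
    using c_der[of t] that e(2) closest_point_self[OF c_C[OF that]] by (simp add: subset_iff)
  have "\<exists>k. \<forall>t\<in>{-e<..<e}. \<alpha> (c t) = k"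
  proof (rule has_derivative_zero_constant)
    fix t assume t: "t \<in> {-e<..<e}"
    have "((\<lambda>t. \<alpha> (c t)) has_derivative (\<lambda>h. 0)) (at t)"
      using chain[OF c_g[OF t]] by (simp add: Dg has_vector_derivative_def)
    then show "((\<lambda>t. \<alpha> (c t)) has_derivative (\<lambda>h. 0)) (at t within {-e<..<e})"
      by (rule has_derivative_at_withinI)
  qed simp
  then obtain k where k: "\<forall>t\<in>{-e<..<e}. \<alpha> (c t) = k" by blast
  have "\<alpha> (c t) = 0" if "t \<in> {-e<..<e}" for t
    using bspec[OF k that] bspec[OF k, of 0] e(1) c0 x0 by simp
  then have "c ` {-e<..<e} \<subseteq> {x. \<alpha> x = 0}" by blast
  moreover have "c C1_differentiable_on {-e<..<e}"
    unfolding C1_differentiable_on_def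
    by (intro exI[of _ "\<lambda>t. g (c t)"] conjI ballI c_g
        continuous_on_compose2[OF g_cont continuous_on_subset[OF c_cont e(2)]]) auto
  \<comment> \<open>The coefficients of the field at \<open>x0\<close> are
    \<open>?D x0 w = 1\<close> and \<open>?D x0 v = 0\<close>, so \<open>g x0 = v\<close>.\<close>
  moreover have "(c has_vector_derivative v) (at 0)"
    using c_g[of 0] e(1) c0 v w by (simp add: g_def)
  ultimately show "v \<in> tangent_space {x. \<alpha> x = 0} x0"
    unfolding tangent_space_def using e(1) c0 by blast
qed

subsection \<open>The return time\<close>

theorem theorem13:
  fixes f :: "real^'n \<Rightarrow> real^'n"
    and \<alpha> :: "real^'n \<Rightarrow> real"
    and tau :: "real^'n \<Rightarrow> real"
    and x0 :: "real^'n" and T :: real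
    and M :: "real^'n^'n" and P :: "(real^'n) set"
  assumes "smooth_on UNIV f"
    and "minimal_period f x0 T"
    and "M = jacobian (flow f T) (at x0)"
    and "alg_multiplicity M 1 = 1"
    and "smooth_on UNIV \<alpha>"
    and "regular_value \<alpha> 0"
    and "P = {x. \<alpha> x = 0}"
    and "local_poincare_section f P x0"
    and "local_return_time f \<alpha> x0 T tau"
  shows "(derivative_kernel tau x0 = tangent_space P x0 \<longleftrightarrow>
            left_eigenvector M 1 (derivative_row \<alpha> x0))
       \<and> (derivative_kernel tau x0 = tangent_space P x0 \<longrightarrow>
            (\<lambda>x. tau x - tau x0) \<in> O[at x0 within P](\<lambda>x. (norm (x - x0))\<^sup>2))"
proof -
  note f = assms(1) and \<alpha> = assms(5)
  have T: "T > 0" and flow_T: "flow f T x0 = x0" and "(T, x0) \<in> flow_domain f"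
    using assms(2) by (simp_all add: minimal_period_def)
  then obtain J y where y: "ivp_solution f x0 J y" and TJ: "T \<in> J"
    by (auto simp: flow_domain_def)
  have yT: "y T = x0"
    using flow_eq[OF f y TJ] T flow_T by simp
  obtain U where tau_T: "tau x0 = T" and U: "open U" "x0 \<in> U" and tau: "smooth_on U tau"
    and ret: "\<And>x. x \<in> U \<Longrightarrow> \<alpha> (flow f (tau x) x) = 0"
    using assms(9) unfolding local_return_time_def by blast
  let ?a = "frechet_derivative \<alpha> (at x0)" and ?t = "frechet_derivative tau (at x0)"
  have \<alpha>0: "\<alpha> x0 = 0"
    using ret[OF U(2)] tau_T flow_T by simp
  then have surj: "surj ?a"
    using assms(6) by (simp add: regular_value_def)
  have TP: "tangent_space P x0 = {v. ?a v = 0}"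
    unfolding assms(7) by (rule tangent_space_level_set[OF \<alpha> \<alpha>0 surj])
  have lin_a: "linear ?a" and lin_t: "linear ?t"
    using smooth_on_bounded_linear_derivative[OF \<alpha> UNIV_I]
      smooth_on_bounded_linear_derivative[OF tau U(2)] bounded_linear.linear by blast+
  define c where "c = ?a (f x0)"
  have "f x0 \<notin> tangent_space P x0"
    using assms(8) unfolding local_poincare_section_def by blast
  then have c: "c \<noteq> 0"
    by (simp add: TP c_def)
  \<comment> \<open>A Jacobian matrix represents the derivative only where one exists, so
    differentiability of the flow has to be supplied.\<close>
  have M: "(flow f T has_derivative (\<lambda>h. M *v h)) (at x0)"
    unfolding assms(3) jacobian_works[symmetric] by (rule flow_differentiable[OF f y TJ T])
  have M_f: "M *v f x0 = f x0"
    using flow_derivative_along_orbit[OF f y TJ T M] yT by simp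
  have return_eq: "?a (M *v h) = - (c * ?t h)" for h
  proof -
    have "((\<lambda>x. flow f (tau x) x) has_derivative (\<lambda>h. M *v h + ?t h *\<^sub>R f x0)) (at x0)"
      using flow_variable_time_has_derivative[OF f y TJ T M U tau tau_T] yT by simp
    then have "((\<lambda>x. \<alpha> (flow f (tau x) x)) has_derivative (\<lambda>h. ?a (M *v h + ?t h *\<^sub>R f x0))) (at x0)"
      by (rule has_derivative_compose) (simp add: tau_T flow_T smooth_on_has_derivative[OF \<alpha>])
    moreover have "((\<lambda>x. \<alpha> (flow f (tau x) x)) has_derivative (\<lambda>h. 0)) (at x0)"
      by (rule has_derivative_transform_within_open[OF has_derivative_const[of 0] U]) (simp add: ret)
    ultimately have "(\<lambda>h. ?a (M *v h + ?t h *\<^sub>R f x0)) = (\<lambda>h. 0)"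
      by (rule has_derivative_unique)
    then have "?a (M *v h + ?t h *\<^sub>R f x0) = 0" by (rule fun_cong)
    then show ?thesis
      by (simp add: linear_add[OF lin_a] linear_scale[OF lin_a] c_def algebra_simps)
  qed
  let ?w = "derivative_row \<alpha> x0"
  have row: "?w \<bullet> h = ?a h" for h
  proof -
    have "?a h = ?a (\<Sum>i\<in>UNIV. h $ i *\<^sub>R axis i 1)"
      by (simp add: basis_expansion scalar_mult_eq_scaleR[symmetric])
    then show ?thesis
      by (simp add: linear_sum[OF lin_a] linear_scale[OF lin_a] derivative_row_def inner_vec_def mult.commute)
  qed
  have "?w \<noteq> 0"
    using row[of "f x0"] c by (auto simp: c_def)
  \<comment> \<open>By adjointness \<open>(?w v* M) \<bullet> h = ?w \<bullet> (M *v h)\<close>, so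
    the row equation can be tested on all vectors \<open>h\<close>.\<close>
  moreover have "?w v* M = ?w \<longleftrightarrow> (\<forall>h. ?a (M *v h) = ?a h)"
    using row dot_lmul_matrix[of ?w M] by (metis vector_eq_rdot)
  ultimately have left_iff: "left_eigenvector M 1 ?w \<longleftrightarrow> (\<forall>h. ?a (M *v h) = ?a h)"
    by (simp add: left_eigenvector_def)
  have kernel_imp: "?t h = - ?a h / c" if ker: "derivative_kernel tau x0 = tangent_space P x0" for h
  proof -
    have ker: "?t v = 0" if "?a v = 0" for v
      using ker that unfolding TP derivative_kernel_def by blast
    have "c * ?t (f x0) = c * - 1" using return_eq[of "f x0"] M_f c_def by simp
    then have t_f: "?t (f x0) = - 1" using c mult_left_cancel by blast
    \<comment> \<open>\<open>f x0\<close> spans a complement of the kernel of \<open>?a\<close>.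
      Removing that component of \<open>h\<close> leaves a tangent vector, which \<open>?t\<close>
      annihilates under the kernel condition.\<close>
    have "?t (h - (?a h / c) *\<^sub>R f x0) = 0"
      by (rule ker) (use c in \<open>simp add: linear_diff[OF lin_a] linear_scale[OF lin_a] c_def\<close>)
    then show ?thesis
      by (simp add: linear_diff[OF lin_t] linear_scale[OF lin_t] t_f)
  qed
  have iff: "derivative_kernel tau x0 = tangent_space P x0 \<longleftrightarrow> left_eigenvector M 1 ?w"
  proof
    assume ker: "derivative_kernel tau x0 = tangent_space P x0"
    show "left_eigenvector M 1 ?w"
      unfolding left_iff return_eq kernel_imp[OF ker] using c by simp
  next
    assume "left_eigenvector M 1 ?w"
    \<comment> \<open>The eigenvector condition turns the return equation into proportionality of
      \<open>?a\<close> and \<open>?t\<close> with factor \<open>- c\<close>, which is nonzero;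
      hence the kernels coincide.\<close>
    then have "?a h = - (c * ?t h)" for h
      using return_eq left_iff by metis
    then show "derivative_kernel tau x0 = tangent_space P x0"
      using c unfolding TP derivative_kernel_def by auto
  qed
  moreover have "(\<lambda>x. tau x - tau x0) \<in> O[at x0 within P](\<lambda>x. (norm (x - x0))\<^sup>2)"
    if ker: "derivative_kernel tau x0 = tangent_space P x0"
  proof -
    obtain q where q: "q > 0" "cball x0 q \<subseteq> U"
      using U open_contains_cball_eq by blast
    let ?C = "cball x0 q"
    have x0C: "x0 \<in> ?C" using q by simp
    obtain K where K: "\<forall>x\<in>?C. \<forall>y\<in>?C. norm (tau y - tau x - frechet_derivative tau (at x) (y - x))
        \<le> K * (norm (y - x))\<^sup>2"
      using smooth_on_taylor[OF tau q(2) compact_cball convex_cball] by (elim exE conjE)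
    obtain K' where K': "\<forall>x\<in>?C. \<forall>y\<in>?C. norm (\<alpha> y - \<alpha> x - frechet_derivative \<alpha> (at x) (y - x))
        \<le> K' * (norm (y - x))\<^sup>2"
      using smooth_on_taylor[OF \<alpha> subset_UNIV compact_cball[of x0 q] convex_cball] by (elim exE conjE)
    \<comment> \<open>\<open>K\<close> bounds the Taylor remainder of \<open>tau\<close>, and
      \<open>K' / \<bar>c\<bar>\<close> its linear part, which equals
      \<open>- ?a (x - x0) / c\<close>.\<close>
    have "norm (tau x - tau x0) \<le> (K + K' / \<bar>c\<bar>) * norm ((norm (x - x0))\<^sup>2)"
      if x: "x \<in> P" "dist x x0 < q" for x
    proof -
      have xC: "x \<in> ?C" using x(2) by (simp add: dist_commute)
      have "\<alpha> x = 0" using x(1) assms(7) by simp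
      \<comment> \<open>Since \<open>\<alpha>\<close> vanishes at both points, its Taylor remainder
        is just \<open>- ?a (x - x0)\<close>.\<close>
      then have "\<bar>?a (x - x0)\<bar> \<le> K' * (norm (x - x0))\<^sup>2"
        using K'[rule_format, OF x0C xC] \<alpha>0 by simp
      then have "\<bar>?a (x - x0)\<bar> / \<bar>c\<bar> \<le> K' * (norm (x - x0))\<^sup>2 / \<bar>c\<bar>"
        by (rule divide_right_mono) simp
      then have "\<bar>?t (x - x0)\<bar> \<le> K' / \<bar>c\<bar> * (norm (x - x0))\<^sup>2"
        by (simp add: kernel_imp[OF ker] abs_divide)
      moreover have "\<bar>tau x - tau x0 - ?t (x - x0)\<bar> \<le> K * (norm (x - x0))\<^sup>2"
        using K[rule_format, OF x0C xC] by simp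
      ultimately have "\<bar>tau x - tau x0\<bar> \<le> K * (norm (x - x0))\<^sup>2 + K' / \<bar>c\<bar> * (norm (x - x0))\<^sup>2"
        by linarith
      then show ?thesis by (simp add: distrib_right)
    qed
    then have "eventually (\<lambda>x. norm (tau x - tau x0) \<le> (K + K' / \<bar>c\<bar>) * norm ((norm (x - x0))\<^sup>2))
        (at x0 within P)"
      unfolding eventually_at using q(1) by blast
    then show ?thesis by (rule bigoI)
  qed
  ultimately show ?thesis by blast
qed

end
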